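(* Let $S$ be a non-abelian finite simple group, let $\mathrm{Inn}(S)\leq X\leq\mathrm{Aut}(S)$, and put $x:=|X/\mathrm{Inn}(S)|$. Let $[V]\neq[W]$ be maximal elements of the poset $\mathcal{P}_X(S)$, with both $V$ and $W$ normally saturating. Suppose some prime $p$ satisfies \[ v_p(|S|)-v_p(|V|)-v_p(|W|)\;>\;v_p(x). \] Then, for every $k\geq2$, no finite group $G$ with unique minimal normal subgroup $N\cong S^k$, whose action on the factors of $N$ has coordinate closure $X$, has property $\mathrm{P}$.
   Context: $v_p$ is the $p$-adic valuation. A finite group $G$ has property $\mathrm{P}$ if $G=AB$ for every pair of maximal subgroups $A,B$ of $G$ that are not conjugate in $G$. Stable classes: for $V\leq S$, $[V]$ is the $S$-conjugacy class of $V$. The class $[V]$ is $X$-stable if the image of $V$ under every $a\in X$ is $S$-conjugate to $V$. Define $\mathcal{P}_X(S):=\{[V] : 1<V<S,\ N_S(V)=V,\ [V]\ X\text{-stable}\}$, partially ordered by $[V]\leq[U]$ iff $V\leq U^s$ for some $s\in S$. A subgroup $V$ is normally saturating if the normal closure $\langle V^W\rangle$ of $V$ in $W$ equals $W$ for every subgroup $W$ with $V\leq W\leq S$. Coordinate closure: let $G$ be a finite group with unique minimal normal subgroup $N\cong S^k$, with simple factors $S_1,\dots,S_k$, each identified with $S$. Conjugation on $N$ embeds $G$ in $\mathrm{Aut}(N)=\mathrm{Aut}(S)\wr S_k$, with $N$ mapping onto $\mathrm{Inn}(S)^k$ and $G$ permuting the factors transitively. Let $G_1$ be the stabilizer in $G$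 of the factor $S_1$ and $\pi_1\colon G_1\to\mathrm{Aut}(S)$ the map recording the automorphism induced on $S_1\cong S$. The coordinate closure of $G$ is $\pi_1(G_1)\cdot\mathrm{Inn}(S)$, a subgroup between $\mathrm{Inn}(S)$ and $\mathrm{Aut}(S)$ (well defined up to conjugacy in $\mathrm{Aut}(S)$). *)

theory Defs
  imports
    "HOL-Algebra.Group_Action"
    "HOL-Algebra.Generated_Groups"
    "HOL-Algebra.Product_Groups"
    "HOL-Algebra.SimpleGroups"
begin

abbreviation conj_subgroup :: "('a, 'm) monoid_scheme \<Rightarrow> 'a \<Rightarrow> 'a set \<Rightarrow> 'a set"
  where "conj_subgroup G g H \<equiv> g <#\<^bsub>G\<^esub> H #>\<^bsub>G\<^esub> inv\<^bsub>G\<^esub> g"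

definition conj_class :: "('a, 'm) monoid_scheme \<Rightarrow> 'a set \<Rightarrow> 'a set set"
  where "conj_class G H = orbit G (conj_subgroup G) H"

definition maximal_subgroup :: "'a set \<Rightarrow> ('a, 'm) monoid_scheme \<Rightarrow> bool"
  where "maximal_subgroup M G \<longleftrightarrow>
    subgroup M G \<and> M \<noteq> carrier G \<and>
    (\<forall>H. subgroup H G \<longrightarrow> M \<subseteq> H \<longrightarrow> H = M \<or> H = carrier G)"

definition property_P :: "('a, 'm) monoid_scheme \<Rightarrow> bool"
  where "property_P G \<longleftrightarrow>
    (\<forall>A B. maximal_subgroup A G \<longrightarrow> maximal_subgroup B G \<longrightarrow> B \<notin> conj_class G A \<longrightarrow>
      A <#>\<^bsub>G\<^esub> B = carrier G)"

definition Inn :: "('a, 'm) monoid_scheme \<Rightarrow> ('a \<Rightarrow> 'a) set"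
  where "Inn S = (\<lambda>g. \<lambda>h\<in>carrier S. g \<otimes>\<^bsub>S\<^esub> h \<otimes>\<^bsub>S\<^esub> inv\<^bsub>S\<^esub> g) ` carrier S"

definition class_stable :: "('a, 'm) monoid_scheme \<Rightarrow> ('a \<Rightarrow> 'a) set \<Rightarrow> 'a set \<Rightarrow> bool"
  where "class_stable S X V \<longleftrightarrow> (\<forall>a\<in>X. a ` V \<in> conj_class S V)"

definition stable_classes ::
    "('a, 'm) monoid_scheme \<Rightarrow> ('a \<Rightarrow> 'a) set \<Rightarrow> 'a set set set"
  where "stable_classes S X =
    {conj_class S V | V. subgroup V S \<and> V \<noteq> {\<one>\<^bsub>S\<^esub>} \<and> V \<noteq> carrier S \<and>
                         normalizer S V = V \<and> class_stable S X V}"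

text \<open>The order on classes is stated through arbitrary representatives \<open>V\<close> and \<open>U\<close>; it does not
  depend on their choice, see \<open>class_le_iff\<close> below.\<close>

definition class_le :: "('a, 'm) monoid_scheme \<Rightarrow> 'a set set \<Rightarrow> 'a set set \<Rightarrow> bool"
  where "class_le S C D \<longleftrightarrow> (\<exists>V\<in>C. \<exists>U\<in>D. \<exists>s\<in>carrier S. V \<subseteq> conj_subgroup S s U)"

definition maximal_stable_class ::
    "('a, 'm) monoid_scheme \<Rightarrow> ('a \<Rightarrow> 'a) set \<Rightarrow> 'a set set \<Rightarrow> bool"
  where "maximal_stable_class S X C \<longleftrightarrow>
    C \<in> stable_classes S X \<and> (\<forall>D\<in>stable_classes S X. class_le S C D \<longrightarrow> D = C)"

definition normal_closure :: "('a, 'm) monoid_scheme \<Rightarrow> 'a set \<Rightarrow> 'a set \<Rightarrow> 'a set"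
  where "normal_closure S W V = generate S (\<Union>w\<in>W. conj_subgroup S w V)"

definition normally_saturating :: "('a, 'm) monoid_scheme \<Rightarrow> 'a set \<Rightarrow> bool"
  where "normally_saturating S V \<longleftrightarrow>
    (\<forall>W. subgroup W S \<longrightarrow> V \<subseteq> W \<longrightarrow> normal_closure S W V = W)"

lemma (in group) conj_subgroup_conj:
  assumes "H \<subseteq> carrier G" "a \<in> carrier G" "b \<in> carrier G"
  shows "conj_subgroup G a (conj_subgroup G b H) = conj_subgroup G (a \<otimes> b) H"
proof -
  have "a <# (b <# H #> inv b) = a <# (b <# H) #> inv b"
    using assms by (simp add: coset_assoc l_coset_subset_G)
  then have "conj_subgroup G a (conj_subgroup G b H) = a <# (b <# H) #> inv b #> inv a"
    by simp
  also have "\<dots> = (a \<otimes> b) <# H #> (inv b \<otimes> inv a)"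
    using assms by (simp add: coset_mult_assoc lcos_m_assoc l_coset_subset_G)
  finally show ?thesis
    using assms by (simp add: inv_mult_group)
qed

lemma (in group) conj_subgroup_mono:
  "H \<subseteq> K \<Longrightarrow> conj_subgroup G a H \<subseteq> conj_subgroup G a K"
  by (auto simp: l_coset_def r_coset_def)

lemma (in group) conj_subgroup_one:
  "H \<subseteq> carrier G \<Longrightarrow> conj_subgroup G \<one> H = H"
  by (simp add: coset_mult_one lcos_mult_one)

lemma (in group) conj_class_self: "H \<subseteq> carrier G \<Longrightarrow> H \<in> conj_class G H"
  unfolding conj_class_def orbit_def using conj_subgroup_one[of H] by blast

lemma (in group) class_le_iff:
  assumes V: "V \<subseteq> carrier G" and U: "U \<subseteq> carrier G"
  shows "class_le G (conj_class G V) (conj_class G U) \<longleftrightarrow>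
    (\<exists>s\<in>carrier G. V \<subseteq> conj_subgroup G s U)"
proof
  assume "class_le G (conj_class G V) (conj_class G U)"
  then obtain a b s where abs: "a \<in> carrier G" "b \<in> carrier G" "s \<in> carrier G"
    and le: "conj_subgroup G a V \<subseteq> conj_subgroup G s (conj_subgroup G b U)"
    unfolding class_le_def conj_class_def orbit_def by blast
  have "V = conj_subgroup G (inv a) (conj_subgroup G a V)"
    using V abs conj_subgroup_conj[of V "inv a" a] conj_subgroup_one[of V] by simp
  also have "\<dots> \<subseteq> conj_subgroup G (inv a) (conj_subgroup G s (conj_subgroup G b U))"
    using le by (rule conj_subgroup_mono)
  also have "\<dots> = conj_subgroup G (inv a \<otimes> (s \<otimes> b)) U"
    using U abs conj_subgroup_conj[of U s b] conj_subgroup_conj[of U "inv a" "s \<otimes> b"] by simp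
  finally show "\<exists>s\<in>carrier G. V \<subseteq> conj_subgroup G s U"
    using abs by (meson inv_closed m_closed)
next
  assume "\<exists>s\<in>carrier G. V \<subseteq> conj_subgroup G s U"
  then show "class_le G (conj_class G V) (conj_class G U)"
    unfolding class_le_def using conj_class_self V U by blast
qed

definition minimal_normal_subgroup :: "'a set \<Rightarrow> ('a, 'm) monoid_scheme \<Rightarrow> bool"
  where "minimal_normal_subgroup N G \<longleftrightarrow>
    N \<lhd> G \<and> N \<noteq> {\<one>\<^bsub>G\<^esub>} \<and>
    (\<forall>M. M \<lhd> G \<longrightarrow> M \<subseteq> N \<longrightarrow> M = {\<one>\<^bsub>G\<^esub>} \<or> M = N)"

definition unique_minimal_normal_subgroup :: "'a set \<Rightarrow> ('a, 'm) monoid_scheme \<Rightarrow> bool"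
  where "unique_minimal_normal_subgroup N G \<longleftrightarrow>
    minimal_normal_subgroup N G \<and> (\<forall>M. minimal_normal_subgroup M G \<longrightarrow> M = N)"

abbreviation power_group :: "('s, 'm) monoid_scheme \<Rightarrow> nat \<Rightarrow> (nat \<Rightarrow> 's) monoid"
  where "power_group S k \<equiv> product_group {..<k} (\<lambda>_. S)"

text \<open>An isomorphism \<open>e\<close> from \<open>S\<^sup>k\<close> onto \<open>N\<close> identifies each simple factor of \<open>N\<close> with \<open>S\<close>:
  \<open>factor_map S k e i\<close> is the resulting isomorphism from \<open>S\<close> onto the \<open>i\<close>-th factor.
  Coordinates are numbered from \<open>0\<close>.\<close>

definition factor_map ::
    "('s, 'm) monoid_scheme \<Rightarrow> nat \<Rightarrow> ((nat \<Rightarrow> 's) \<Rightarrow> 'g) \<Rightarrow> nat \<Rightarrow> 's \<Rightarrow> 'g"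
  where "factor_map S k e i s = e (\<lambda>j\<in>{..<k}. if j = i then s else \<one>\<^bsub>S\<^esub>)"

text \<open>For \<open>g\<close> normalizing the factor \<open>f ` carrier S\<close>, this is the automorphism that conjugation
  by \<open>g\<close> induces on the factor, transported to \<open>S\<close> along \<open>f\<close>.\<close>

definition induced_aut ::
    "('s, 'm) monoid_scheme \<Rightarrow> ('g, 'n) monoid_scheme \<Rightarrow> ('s \<Rightarrow> 'g) \<Rightarrow> 'g \<Rightarrow> 's \<Rightarrow> 's"
  where "induced_aut S G f g =
    (\<lambda>s\<in>carrier S. inv_into (carrier S) f (g \<otimes>\<^bsub>G\<^esub> f s \<otimes>\<^bsub>G\<^esub> inv\<^bsub>G\<^esub> g))"

definition coordinate_closure ::
    "('s, 'm) monoid_scheme \<Rightarrow> ('g, 'n) monoid_scheme \<Rightarrow> nat \<Rightarrow> ((nat \<Rightarrow> 's) \<Rightarrow> 'g) \<Rightarrow>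
      ('s \<Rightarrow> 's) set"
  where "coordinate_closure S G k e =
    (let f = factor_map S k e 0;
         G\<^sub>1 = stabilizer G (conj_subgroup G) (f ` carrier S)
     in induced_aut S G f ` G\<^sub>1 <#>\<^bsub>AutoGroup S\<^esub> Inn S)"

end

theory Submission
  imports Defs
begin

text \<open>Write \<open>N\<close> as the product of its simple factors and let \<open>V\<^sub>i\<close> be a translate of \<open>V\<close> in the
  \<open>i\<close>-th factor under some element of \<open>G\<close> moving factor \<open>0\<close> there. As the class of \<open>V\<close> is
  \<open>X\<close>-stable, every \<open>G\<close>-conjugate of the product of the \<open>V\<^sub>i\<close> is an \<open>N\<close>-conjugate, so its normalizer
  \<open>A\<close> satisfies \<open>G = N A\<close>; as \<open>V\<close> is self-normalizing, \<open>A \<inter> N\<close> is that product. If \<open>A \<le> M\<close> and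
  \<open>R\<close> is the projection of \<open>M \<inter> N\<close> to factor \<open>0\<close>, then normal saturation puts \<open>R\<close>, as a subgroup of
  this factor, inside \<open>M\<close>, and makes \<open>R\<close> self-normalizing; its class is \<open>X\<close>-stable, so maximality of
  \<open>[V]\<close> leaves only \<open>R = V\<close>, where \<open>M = A\<close>, and \<open>R = S\<close>, where \<open>M = G\<close>. Hence \<open>A\<close> is maximal, and
  likewise the subgroup \<open>B\<close> obtained from \<open>W\<close>; they are not conjugate. If \<open>G = A B\<close>, comparing orders
  shows that \<open>|S|\<^sup>k\<close> divides \<open>|V|\<^sup>k |W|\<^sup>k |G/N|\<close>, while \<open>|G/N|\<close> divides \<open>k! x\<^sup>k\<close> because \<open>G\<close>
  permutes the factors and the kernel of this action embeds modulo \<open>N\<close> in \<open>(X/Inn S)\<^sup>k\<close>. Since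
  \<open>v\<^sub>p(k!) < k\<close>, this contradicts the hypothesis on \<open>p\<close>.\<close>

section \<open>Factorials, conjugation and orders\<close>

text \<open>One step of Legendre's formula: only the multiples of p contribute, each giving up one
  factor p and leaving together the factors of (n div p)!.\<close>

lemma multiplicity_fact:
  fixes p :: nat
  assumes p: "prime p"
  shows "multiplicity p (fact n :: nat) = n div p + multiplicity p (fact (n div p) :: nat)"
proof (induction n)
  case (Suc n)
  have pe: "prime_elem p" using p by simp
  have m: "multiplicity p (fact (Suc n) :: nat) = multiplicity p (Suc n) + multiplicity p (fact n :: nat)" for n
    by (simp only: fact_Suc of_nat_id) (subst prime_elem_multiplicity_mult_distrib[OF pe]; simp)
  show ?case
  proof (cases "p dvd Suc n")
    case True
    then have d: "Suc n div p = Suc (n div p)" by (simp add: dvd_eq_mod_eq_0 mod_Suc div_Suc split: if_splits)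
    have "Suc n = p * (Suc (n div p))" using True d by (metis dvd_mult_div_cancel)
    then have "multiplicity p (Suc n) = Suc (multiplicity p (Suc (n div p)))"
      using p by (metis multiplicity_times_same nat.simps(3) not_prime_unit prime_gt_0_nat neq0_conv)
    then show ?thesis using Suc m[of n] m[of "n div p"] d by presburger
  next
    case False
    then have "Suc n div p = n div p" by (simp add: dvd_eq_mod_eq_0 div_Suc)
    moreover have "multiplicity p (Suc n) = 0" using False by (rule not_dvd_imp_multiplicity_0)
    ultimately show ?thesis using Suc m[of n] by presburger
  qed
qed simp

text \<open>For m = n div p > 0 the recursion gives m + v(m!), and induction bounds this strictly
  below 2m, which is at most n. The strictness is what absorbs the permutations of the k factors in
  the final count.\<close>

lemma multiplicity_fact_less:
  fixes p :: nat
  assumes p: "prime p" and "0 < n"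
  shows "multiplicity p (fact n :: nat) < n"
  using \<open>0 < n\<close>
proof (induction n rule: less_induct)
  case (less n)
  show ?case
  proof (cases "n div p = 0")
    case True
    then show ?thesis using multiplicity_fact[OF p, of n] less.prems by simp
  next
    case False
    have "n div p * 2 \<le> n div p * p" using prime_ge_2_nat[OF p] by simp
    also have "\<dots> \<le> n" by simp
    finally have "n div p * 2 \<le> n" .
    moreover have "multiplicity p (fact (n div p) :: nat) < n div p"
      using False less by (intro less.IH) (use \<open>n div p * 2 \<le> n\<close> in auto)
    ultimately show ?thesis using multiplicity_fact[OF p, of n] by linarith
  qed
qed

section \<open>Conjugation as a map on elements\<close>

definition conj_by :: "('a, 'm) monoid_scheme \<Rightarrow> 'a \<Rightarrow> 'a \<Rightarrow> 'a"
  where "conj_by G g x = g \<otimes>\<^bsub>G\<^esub> x \<otimes>\<^bsub>G\<^esub> inv\<^bsub>G\<^esub> g"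

lemma conj_subgroup_image: "conj_subgroup G g H = conj_by G g ` H"
  by (auto simp: l_coset_def r_coset_def conj_by_def)

context group
begin

lemma conj_by_closed [simp, intro]:
  "g \<in> carrier G \<Longrightarrow> x \<in> carrier G \<Longrightarrow> conj_by G g x \<in> carrier G"
  by (simp add: conj_by_def)

lemma conj_by_mult:
  "g \<in> carrier G \<Longrightarrow> x \<in> carrier G \<Longrightarrow> y \<in> carrier G \<Longrightarrow>
    conj_by G g (x \<otimes> y) = conj_by G g x \<otimes> conj_by G g y"
  by (simp add: conj_by_def m_assoc inv_solve_left)

lemma conj_by_comp:
  "g \<in> carrier G \<Longrightarrow> h \<in> carrier G \<Longrightarrow> x \<in> carrier G \<Longrightarrow>
    conj_by G g (conj_by G h x) = conj_by G (g \<otimes> h) x"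
  by (simp add: conj_by_def m_assoc inv_mult_group)

lemma conj_by_one [simp]: "x \<in> carrier G \<Longrightarrow> conj_by G \<one> x = x"
  by (simp add: conj_by_def)

lemma conj_by_of_one [simp]: "g \<in> carrier G \<Longrightarrow> conj_by G g \<one> = \<one>"
  by (simp add: conj_by_def)

lemma conj_by_inv_cancel [simp]:
  assumes "g \<in> carrier G" "x \<in> carrier G"
  shows "conj_by G (inv g) (conj_by G g x) = x" "conj_by G g (conj_by G (inv g) x) = x"
  using assms by (simp_all add: conj_by_comp)

lemma conj_by_eq_iff [simp]:
  assumes "g \<in> carrier G" "x \<in> carrier G" "y \<in> carrier G"
  shows "conj_by G g x = conj_by G g y \<longleftrightarrow> x = y"
  using assms by (metis conj_by_inv_cancel(1))

lemma conj_by_fixed_iff: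
  "g \<in> carrier G \<Longrightarrow> x \<in> carrier G \<Longrightarrow> conj_by G g x = x \<longleftrightarrow> g \<otimes> x = x \<otimes> g"
  by (metis conj_by_def inv_solve_right m_closed)

lemma conj_by_image_comp:
  "g \<in> carrier G \<Longrightarrow> h \<in> carrier G \<Longrightarrow> H \<subseteq> carrier G \<Longrightarrow>
    conj_by G g ` conj_by G h ` H = conj_by G (g \<otimes> h) ` H"
  unfolding image_image by (rule image_cong) (auto simp: conj_by_comp)

lemma conj_by_image_one: "H \<subseteq> carrier G \<Longrightarrow> conj_by G \<one> ` H = H"
  by (force simp: subset_iff)

lemma conj_by_image_inv_cancel:
  assumes "g \<in> carrier G" "H \<subseteq> carrier G"
  shows "conj_by G (inv g) ` conj_by G g ` H = H" "conj_by G g ` conj_by G (inv g) ` H = H"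
  using assms by (simp_all add: conj_by_image_comp conj_by_image_one)

lemma conj_by_image_subset_carrier:
  "g \<in> carrier G \<Longrightarrow> H \<subseteq> carrier G \<Longrightarrow> conj_by G g ` H \<subseteq> carrier G"
  by auto

lemma conj_by_image_self:
  assumes H: "subgroup H G" and h: "h \<in> H"
  shows "conj_by G h ` H = H"
proof -
  interpret subgroup H G by fact
  have sub: "conj_by G a ` H \<subseteq> H" if "a \<in> H" for a using that by (auto simp: conj_by_def)
  have "H = conj_by G h ` conj_by G (inv h) ` H"
    using h subset by (simp add: conj_by_image_inv_cancel(2))
  also have "\<dots> \<subseteq> conj_by G h ` H" using h by (intro image_mono sub) simp
  finally show ?thesis using sub[OF h] by blast
qed

lemma card_conj_by_image:
  "g \<in> carrier G \<Longrightarrow> H \<subseteq> carrier G \<Longrightarrow> card (conj_by G g ` H) = card H"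
  by (rule card_image) (auto simp: inj_on_def subset_iff)

lemma conj_class_iff: "K \<in> conj_class G H \<longleftrightarrow> (\<exists>g\<in>carrier G. K = conj_by G g ` H)"
  by (auto simp: conj_class_def orbit_def conj_subgroup_image)

lemma conj_class_eqI:
  assumes H: "H \<subseteq> carrier G" and g: "g \<in> carrier G"
  shows "conj_class G (conj_by G g ` H) = conj_class G H"
proof
  show "conj_class G (conj_by G g ` H) \<subseteq> conj_class G H"
    using H g by (auto simp: conj_class_iff conj_by_image_comp intro!: bexI[of _ "_ \<otimes> g"])
  have "conj_by G a ` H = conj_by G (a \<otimes> inv g) ` conj_by G g ` H" if "a \<in> carrier G" for a
    using that H g by (simp add: conj_by_image_comp m_assoc)
  then show "conj_class G H \<subseteq> conj_class G (conj_by G g ` H)"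
    using g unfolding conj_class_iff subset_iff by (metis inv_closed m_closed)
qed

lemma normalizer_iff:
  assumes "H \<subseteq> carrier G"
  shows "g \<in> normalizer G H \<longleftrightarrow> g \<in> carrier G \<and> conj_by G g ` H = H"
  using assms by (auto simp: normalizer_def stabilizer_def conj_subgroup_image)

text \<open>Every fibre of the multiplication map from A x B onto AB is a copy of the intersection:
  the pairs over \<open>a b\<close> are the pairs \<open>(a c, inv c b)\<close> with c in both
  subgroups.\<close>

lemma card_set_mult:
  assumes A: "subgroup A G" and B: "subgroup B G" and fin: "finite (carrier G)"
  shows "card (A <#> B) * card (A \<inter> B) = card A * card B"
proof -
  interpret A: subgroup A G by fact
  interpret B: subgroup B G by fact
  have fA: "finite A" and fB: "finite B" using fin A.subset B.subset finite_subset by blast+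
  let ?m = "\<lambda>(a, b). a \<otimes> b"
  have fib: "card {ab \<in> A \<times> B. ?m ab = y} = card (A \<inter> B)" if "y \<in> A <#> B" for y
  proof -
    from that obtain a b where ab: "a \<in> A" "b \<in> B" "y = a \<otimes> b" by (auto simp: set_mult_def)
    have "bij_betw (\<lambda>c. (a \<otimes> c, inv c \<otimes> b)) (A \<inter> B) {ab \<in> A \<times> B. ?m ab = y}"
    proof (intro bij_betwI')
      fix c d assume "c \<in> A \<inter> B" "d \<in> A \<inter> B"
      then show "((a \<otimes> c, inv c \<otimes> b) = (a \<otimes> d, inv d \<otimes> b)) = (c = d)" using ab by auto
    next
      fix c assume "c \<in> A \<inter> B"
      moreover have "a \<otimes> c \<otimes> (inv c \<otimes> b) = a \<otimes> b" if "c \<in> A"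
        using that ab by (metis A.mem_carrier B.mem_carrier inv_closed inv_solve_left m_assoc m_closed)
      ultimately show "(a \<otimes> c, inv c \<otimes> b) \<in> {ab \<in> A \<times> B. ?m ab = y}" using ab by auto
    next
      fix z assume "z \<in> {ab \<in> A \<times> B. ?m ab = y}"
      then obtain a' b' where z: "z = (a', b')" "a' \<in> A" "b' \<in> B" "a' \<otimes> b' = a \<otimes> b" using ab by auto
      let ?c = "inv a \<otimes> a'"
      have c: "?c = b \<otimes> inv b'" using z ab
        by (metis A.mem_carrier B.mem_carrier inv_closed inv_solve_left inv_solve_right m_assoc m_closed)
      \<comment> \<open>The defining form of \<open>?c\<close> puts it in A; the second form,
        obtained from \<open>a' b' = a b\<close>, puts it in B.\<close>
      have "?c \<in> A \<inter> B" using z ab c by (metis A.m_closed A.m_inv_closed B.m_closed B.m_inv_closed IntI)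
      moreover have "a \<otimes> ?c = a'" using z ab by (simp add: m_assoc[symmetric])
      moreover have "inv ?c \<otimes> b = b'" unfolding c using z ab
        by (simp add: inv_mult_group m_assoc)
      ultimately show "\<exists>c\<in>A \<inter> B. z = (a \<otimes> c, inv c \<otimes> b)"
        unfolding z(1) by (intro bexI[of _ ?c]) simp_all
    qed
    then show ?thesis by (simp add: bij_betw_same_card)
  qed
  have "card A * card B = card (A \<times> B)" by (simp add: card_cartesian_product)
  also have "A \<times> B = (\<Union>y\<in>A <#> B. {ab \<in> A \<times> B. ?m ab = y})" by (auto simp: set_mult_def)
  also have "card \<dots> = (\<Sum>y\<in>A <#> B. card {ab \<in> A \<times> B. ?m ab = y})"
    using fA fB by (intro card_UN_disjoint) (auto intro: finite_subset[of _ "A \<times> B"] simp: set_mult_def)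
  also have "\<dots> = card (A <#> B) * card (A \<inter> B)" using fib by simp
  finally show ?thesis by simp
qed

end

text \<open>The first isomorphism theorem for the corestriction to the image, followed by Lagrange
  for the image inside H.\<close>

lemma (in group_hom) order_dvd_card_kernel:
  shows "order G dvd order H * card (kernel G H h)"
proof -
  have k: "subgroup (kernel G H h) G" by (rule subgroup_kernel)
  interpret im: subgroup "h ` carrier G" H by (rule img_is_subgroup)
  interpret I: group "H\<lparr>carrier := h ` carrier G\<rparr>" by (rule H.subgroup_imp_group) (rule img_is_subgroup)
  interpret r: group_hom G "H\<lparr>carrier := h ` carrier G\<rparr>" h
    by unfold_locales (auto simp: hom_def)
  have "kernel G (H\<lparr>carrier := h ` carrier G\<rparr>) h = kernel G H h" by (simp add: kernel_def)
  then have "card (rcosets (kernel G H h)) = card (h ` carrier G)"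
    using r.FactGroup_iso_set by (force simp: iso_def FactGroup_def dest: bij_betw_same_card)
  then have "order G = card (h ` carrier G) * card (kernel G H h)"
    using G.lagrange[OF k] by simp
  moreover have "card (h ` carrier G) dvd order H"
    using H.lagrange[OF img_is_subgroup] by (metis dvd_triv_right)
  ultimately show ?thesis by simp
qed

section \<open>Groups whose socle is a power of a simple group\<close>

lemma auto_closed: "\<alpha> \<in> auto S \<Longrightarrow> s \<in> carrier S \<Longrightarrow> \<alpha> s \<in> carrier S"
  by (auto simp: auto_def hom_def)

lemma auto_mult:
  "\<alpha> \<in> auto S \<Longrightarrow> s \<in> carrier S \<Longrightarrow> t \<in> carrier S \<Longrightarrow> \<alpha> (s \<otimes>\<^bsub>S\<^esub> t) = \<alpha> s \<otimes>\<^bsub>S\<^esub> \<alpha> t"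
  by (auto simp: auto_def hom_def)

lemma auto_inj_on: "\<alpha> \<in> auto S \<Longrightarrow> inj_on \<alpha> (carrier S)"
  by (auto simp: auto_def Bij_def bij_betw_def)

lemma auto_surj: "\<alpha> \<in> auto S \<Longrightarrow> \<alpha> ` carrier S = carrier S"
  by (auto simp: auto_def Bij_def bij_betw_def)

context group
begin

lemma auto_inv:
  assumes a: "\<alpha> \<in> auto G" and s: "s \<in> carrier G"
  shows "\<alpha> (inv s) = inv \<alpha> s"
proof -
  interpret group_hom G G \<alpha> using a by unfold_locales (simp add: auto_def)
  show ?thesis using s by simp
qed

lemma auto_conj_by:
  "\<alpha> \<in> auto G \<Longrightarrow> s \<in> carrier G \<Longrightarrow> t \<in> carrier G \<Longrightarrow>
    \<alpha> (conj_by G s t) = conj_by G (\<alpha> s) (\<alpha> t)"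
  by (simp add: conj_by_def auto_mult auto_closed auto_inv)

lemma auto_conj_by_image:
  "\<alpha> \<in> auto G \<Longrightarrow> s \<in> carrier G \<Longrightarrow> H \<subseteq> carrier G \<Longrightarrow>
    \<alpha> ` conj_by G s ` H = conj_by G (\<alpha> s) ` \<alpha> ` H"
  unfolding image_image by (rule image_cong) (auto simp: auto_conj_by)

text \<open>The centre \<open>?Z\<close> is normal and, in a non-abelian group, proper, so
  simplicity makes it trivial. Equal actions of c and d put \<open>inv d c\<close> into it.\<close>

lemma simple_conj_by_inj:
  assumes simple: "simple_group G" and nc: "\<not> comm_group G"
    and c: "c \<in> carrier G" and d: "d \<in> carrier G"
    and eq: "\<And>t. t \<in> carrier G \<Longrightarrow> conj_by G c t = conj_by G d t"
  shows "c = d"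
proof -
  let ?Z = "{c \<in> carrier G. \<forall>t\<in>carrier G. conj_by G c t = t}"
  have "subgroup ?Z G"
  proof (rule subgroupI)
    show "inv a \<in> ?Z" if "a \<in> ?Z" for a
      using that by (smt (verit) conj_by_inv_cancel(1) inv_closed mem_Collect_eq)
    show "a \<otimes> b \<in> ?Z" if "a \<in> ?Z" "b \<in> ?Z" for a b
      using that by (auto simp: conj_by_comp[symmetric])
    show "?Z \<noteq> {}" using conj_by_one by blast
  qed auto
  moreover have "x \<otimes> h \<otimes> inv x \<in> ?Z" if x: "x \<in> carrier G" and h: "h \<in> ?Z" for x h
  proof -
    have "x \<otimes> h = h \<otimes> x" using x h conj_by_fixed_iff[of h x] by auto
    then have "x \<otimes> h \<otimes> inv x = h" using x h by (simp add: m_assoc)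
    then show ?thesis using h by simp
  qed
  ultimately have "?Z \<lhd> G" by (auto simp: normal_inv_iff)
  then have Z: "?Z = carrier G \<or> ?Z = {\<one>}"
    using simple by (simp add: simple_group.no_real_normal_subgroup)
  have "?Z \<noteq> carrier G"
  proof
    assume Z: "?Z = carrier G"
    have "comm_group G"
    proof (rule group_comm_groupI)
      fix x y assume xy: "x \<in> carrier G" "y \<in> carrier G"
      then have "conj_by G x y = y" using Z by blast
      then show "x \<otimes> y = y \<otimes> x" using xy by (simp add: conj_by_fixed_iff)
    qed
    then show False using nc by contradiction
  qed
  with Z have "?Z = {\<one>}" by blast
  moreover have "inv d \<otimes> c \<in> ?Z" using c d eq by (auto simp: conj_by_comp[symmetric])
  ultimately have "inv d \<otimes> c = \<one>" by blast
  then show ?thesis using c d by (metis inv_closed inv_equality inv_inv)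
qed

end

text \<open>Transitivity of G on the factors is not assumed; \<open>transitive\<close> derives it
  from the minimality of N.\<close>

locale simple_power_socle = S: simple_group S + G: group G
  for S :: "('s, 'm) monoid_scheme" and G :: "('g, 'n) monoid_scheme" (structure) +
  fixes N :: "'g set" and k :: nat and e :: "(nat \<Rightarrow> 's) \<Rightarrow> 'g"
  assumes S_finite: "finite (carrier S)"
    and S_not_comm: "\<not> comm_group S"
    and G_finite: "finite (carrier G)"
    and N_minimal: "unique_minimal_normal_subgroup N G"
    and e_iso: "e \<in> iso (power_group S k) (G\<lparr>carrier := N\<rparr>)"
    and k_pos: "0 < k"
begin

abbreviation P :: "(nat \<Rightarrow> 's) set"
  where "P \<equiv> {..<k} \<rightarrow>\<^sub>E carrier S"

abbreviation f :: "nat \<Rightarrow> 's \<Rightarrow> 'g"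
  where "f \<equiv> factor_map S k e"

abbreviation F :: "nat \<Rightarrow> 'g set"
  where "F i \<equiv> f i ` carrier S"

lemma N_normal: "N \<lhd> G"
  using N_minimal by (simp add: unique_minimal_normal_subgroup_def minimal_normal_subgroup_def)

sublocale N: normal N G
  by (rule N_normal)

lemma N_conj: "g \<in> carrier G \<Longrightarrow> n \<in> N \<Longrightarrow> conj_by G g n \<in> N"
  by (simp add: conj_by_def N.inv_op_closed2)

lemma e_bij: "bij_betw e P N"
  using e_iso by (simp add: iso_def)

lemma e_closed [simp, intro]: "x \<in> P \<Longrightarrow> e x \<in> N"
  using e_bij by (auto simp: bij_betw_def)

lemma e_in_carrier [simp, intro]: "x \<in> P \<Longrightarrow> e x \<in> carrier G"
  using N.subset by auto

lemma e_surj: assumes "n \<in> N" obtains x where "x \<in> P" "n = e x"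
  using e_bij assms by (auto simp: bij_betw_def)

lemma e_eq_iff: "x \<in> P \<Longrightarrow> y \<in> P \<Longrightarrow> e x = e y \<longleftrightarrow> x = y"
  using e_bij by (auto simp: bij_betw_def inj_on_def)

sublocale E: group_hom "power_group S k" G e
proof (intro group_hom.intro group_hom_axioms.intro)
  show "e \<in> hom (power_group S k) G"
    using e_iso N.subset by (auto simp: iso_def hom_def)
qed simp_all

lemma e_mult: "x \<in> P \<Longrightarrow> y \<in> P \<Longrightarrow> e x \<otimes> e y = e (\<lambda>i\<in>{..<k}. x i \<otimes>\<^bsub>S\<^esub> y i)"
  using E.hom_mult[of x y] by simp

lemma e_inv: "x \<in> P \<Longrightarrow> inv (e x) = e (\<lambda>i\<in>{..<k}. inv\<^bsub>S\<^esub> x i)"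
  using E.hom_inv[of x] by simp

lemma e_one: "e (\<lambda>i\<in>{..<k}. \<one>\<^bsub>S\<^esub>) = \<one>"
  using E.hom_one by simp

lemma e_conj:
  assumes x: "x \<in> P" and y: "y \<in> P"
  shows "conj_by G (e x) (e y) = e (\<lambda>i\<in>{..<k}. conj_by S (x i) (y i))"
proof -
  have xy: "(\<lambda>i\<in>{..<k}. x i \<otimes>\<^bsub>S\<^esub> y i) \<in> P" "(\<lambda>i\<in>{..<k}. inv\<^bsub>S\<^esub> x i) \<in> P"
    using x y by (simp_all add: PiE_iff)
  have "conj_by G (e x) (e y) = e (\<lambda>i\<in>{..<k}. (\<lambda>i\<in>{..<k}. x i \<otimes>\<^bsub>S\<^esub> y i) i \<otimes>\<^bsub>S\<^esub> (\<lambda>i\<in>{..<k}. inv\<^bsub>S\<^esub> x i) i)"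
    unfolding conj_by_def e_mult[OF x y] e_inv[OF x] e_mult[OF xy] ..
  also have "\<dots> = e (\<lambda>i\<in>{..<k}. conj_by S (x i) (y i))"
    unfolding conj_by_def by (intro arg_cong[of _ _ e] restrict_ext) simp
  finally show ?thesis .
qed

section \<open>Coordinate embeddings and the simple factors of N\<close>

definition inj_at :: "nat \<Rightarrow> 's \<Rightarrow> nat \<Rightarrow> 's"
  where "inj_at i s = (\<lambda>j\<in>{..<k}. if j = i then s else \<one>\<^bsub>S\<^esub>)"

lemma f_eq: "f i s = e (inj_at i s)"
  by (simp add: factor_map_def inj_at_def)

lemma inj_at_in [simp, intro]: "s \<in> carrier S \<Longrightarrow> inj_at i s \<in> P"
  by (auto simp: inj_at_def)

lemma inj_at_apply [simp]: "j < k \<Longrightarrow> inj_at i s j = (if j = i then s else \<one>\<^bsub>S\<^esub>)"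
  by (simp add: inj_at_def)

lemma P_eqI: "x \<in> P \<Longrightarrow> y \<in> P \<Longrightarrow> (\<And>i. i < k \<Longrightarrow> x i = y i) \<Longrightarrow> x = y"
  by (rule PiE_ext) auto

lemma P_apply: "x \<in> P \<Longrightarrow> i < k \<Longrightarrow> x i \<in> carrier S"
  by auto

lemma f_N [simp, intro]: "s \<in> carrier S \<Longrightarrow> f i s \<in> N"
  by (simp add: f_eq)

lemma f_closed [simp, intro]: "s \<in> carrier S \<Longrightarrow> f i s \<in> carrier G"
  using N.subset by auto

lemma f_eq_iff:
  "i < k \<Longrightarrow> s \<in> carrier S \<Longrightarrow> t \<in> carrier S \<Longrightarrow> f i s = f i t \<longleftrightarrow> s = t"
  by (metis f_eq e_eq_iff inj_at_in inj_at_apply)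

lemma f_mult:
  assumes "s \<in> carrier S" "t \<in> carrier S"
  shows "f i (s \<otimes>\<^bsub>S\<^esub> t) = f i s \<otimes> f i t"
  using assms by (auto simp: f_eq e_mult inj_at_def intro!: arg_cong[of _ _ e])

lemma f_hom: "group_hom S G (f i)"
  by (intro group_hom.intro group_hom_axioms.intro homI) (auto simp: f_mult)

lemma f_one [simp]: "f i \<one>\<^bsub>S\<^esub> = \<one>"
  by (rule group_hom.hom_one[OF f_hom])

lemma f_inv: "s \<in> carrier S \<Longrightarrow> f i (inv\<^bsub>S\<^esub> s) = inv (f i s)"
  by (rule group_hom.hom_inv[OF f_hom])

lemma F_subset: "F i \<subseteq> N"
  by auto

lemma e_conj_f:
  assumes "x \<in> P" "s \<in> carrier S" "i < k"
  shows "conj_by G (e x) (f i s) = f i (conj_by S (x i) s)"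
proof -
  have "conj_by G (e x) (f i s) = e (\<lambda>j\<in>{..<k}. conj_by S (x j) (inj_at i s j))"
    using assms by (simp add: f_eq e_conj)
  also have "(\<lambda>j\<in>{..<k}. conj_by S (x j) (inj_at i s j)) = inj_at i (conj_by S (x i) s)"
    unfolding inj_at_def by (rule restrict_ext) (simp add: P_apply[OF assms(1)])
  finally show ?thesis by (simp add: f_eq)
qed

lemma S_nontrivial: obtains s where "s \<in> carrier S" "s \<noteq> \<one>\<^bsub>S\<^esub>"
  using S.simple_not_triv by blast

lemma F_inj:
  assumes "i < k" "j < k" "F i \<subseteq> F j"
  shows "i = j"
proof (rule ccontr)
  assume "i \<noteq> j"
  obtain s where s: "s \<in> carrier S" "s \<noteq> \<one>\<^bsub>S\<^esub>" by (rule S_nontrivial)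
  then obtain t where t: "t \<in> carrier S" "f i s = f j t" using assms by blast
  then have "inj_at i s = inj_at j t" using s by (simp add: f_eq e_eq_iff)
  then have "inj_at i s i = inj_at j t i" by simp
  then show False using assms s \<open>i \<noteq> j\<close> by simp
qed

text \<open>An element of M with a nontrivial coordinate i has a nontrivial commutator with some
  element of factor i. Hence M meets this factor nontrivially, and the intersection, being normal in
  the factor, is all of it.\<close>

lemma normal_contains_factor:
  assumes M: "subgroup M G" "M \<subseteq> N" "M \<noteq> {\<one>}"
    and inv: "\<And>n m. n \<in> N \<Longrightarrow> m \<in> M \<Longrightarrow> conj_by G n m \<in> M"
  shows "\<exists>i<k. F i \<subseteq> M"
proof -
  interpret M: subgroup M G by fact
  obtain m where m: "m \<in> M" "m \<noteq> \<one>" using M(3) M.one_closed by blast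
  obtain x where x: "x \<in> P" "m = e x" using m M by (blast elim: e_surj)
  have "\<exists>i<k. x i \<noteq> \<one>\<^bsub>S\<^esub>"
  proof (rule ccontr)
    assume "\<not> ?thesis"
    then have "x = (\<lambda>i\<in>{..<k}. \<one>\<^bsub>S\<^esub>)" using x by (intro P_eqI) auto
    then show False using x m e_one by simp
  qed
  then obtain i where i: "i < k" "x i \<noteq> \<one>\<^bsub>S\<^esub>" by blast
  have xi: "x i \<in> carrier S" using x(1) i(1) by (rule P_apply)
  obtain s where s: "s \<in> carrier S" "conj_by S (x i) s \<noteq> s"
    using S.simple_conj_by_inj[OF S.is_simple_group S_not_comm xi, of "\<one>\<^bsub>S\<^esub>"] i
    by (metis S.conj_by_one S.one_closed)
  let ?T = "{t \<in> carrier S. f i t \<in> M}"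
  have "subgroup ?T S"
    by (rule S.subgroupI) (auto simp: f_inv f_mult intro: exI[of _ "\<one>\<^bsub>S\<^esub>"])
  moreover have "r \<otimes>\<^bsub>S\<^esub> t \<otimes>\<^bsub>S\<^esub> inv\<^bsub>S\<^esub> r \<in> ?T" if "r \<in> carrier S" "t \<in> ?T" for r t
    using that i inv[of "e (inj_at i r)" "f i t"] by (simp add: e_conj_f) (simp add: conj_by_def)
  ultimately have "?T \<lhd> S" by (auto simp: S.normal_inv_iff)
  then have T: "?T = carrier S \<or> ?T = {\<one>\<^bsub>S\<^esub>}" by (rule S.no_real_normal_subgroup)
  let ?c = "conj_by S (x i) s \<otimes>\<^bsub>S\<^esub> inv\<^bsub>S\<^esub> s"
  \<comment> \<open>The commutator is read in two ways: as a conjugate of \<open>f i s\<close> times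
    its inverse it lies in factor i, and as m times a conjugate of \<open>inv m\<close> it lies in
    M.\<close>
  have "f i ?c = m \<otimes> conj_by G (f i s) (inv m)"
    using x s i xi by (simp add: f_mult f_inv e_conj_f[symmetric]) (simp add: conj_by_def G.m_assoc)
  also have "\<dots> \<in> M" using m s by (simp add: inv)
  finally have "?c \<in> ?T" using s xi by simp
  moreover have "?c \<noteq> \<one>\<^bsub>S\<^esub>" using s xi by (metis S.conj_by_closed S.inv_closed S.inv_equality S.inv_inv)
  ultimately have "?T = carrier S" using T by auto
  then show ?thesis using i by blast
qed

lemma subgroup_conj_by_image:
  assumes "subgroup H G" "g \<in> carrier G"
  shows "subgroup (conj_by G g ` H) G"
proof -
  have "group_hom G G (conj_by G g)"
    using assms by (intro group_hom.intro group_hom_axioms.intro homI) (auto simp: G.conj_by_mult)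
  then show ?thesis by (rule group_hom.subgroup_img_is_subgroup) (rule assms)
qed

lemma subgroup_F: "subgroup (F i) G"
  using group_hom.img_is_subgroup[OF f_hom] .

text \<open>A conjugate of a factor is again a nontrivial subgroup normalized by N: conjugation by n
  can be moved inside as conjugation by an element of N, which preserves factor i.\<close>

lemma conj_F_contains:
  assumes g: "g \<in> carrier G" and i: "i < k"
  shows "\<exists>j<k. F j \<subseteq> conj_by G g ` F i"
proof (rule normal_contains_factor)
  show "subgroup (conj_by G g ` F i) G"
    by (rule subgroup_conj_by_image[OF subgroup_F g])
  show "conj_by G g ` F i \<subseteq> N" using g F_subset by (auto simp: N_conj)
  obtain s where s: "s \<in> carrier S" "s \<noteq> \<one>\<^bsub>S\<^esub>" by (rule S_nontrivial)
  then have "f i s \<noteq> \<one>" using i by (metis f_eq_iff f_one S.one_closed)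
  then have "conj_by G g (f i s) \<noteq> \<one>" using g s by (metis G.conj_by_eq_iff G.conj_by_of_one G.one_closed f_closed)
  then show "conj_by G g ` F i \<noteq> {\<one>}" using s by blast
  fix n m assume n: "n \<in> N" and "m \<in> conj_by G g ` F i"
  then obtain s where s: "s \<in> carrier S" "m = conj_by G g (f i s)" by blast
  have "conj_by G (inv g) n \<in> N" using n g by (simp add: N_conj)
  then obtain x where x: "x \<in> P" "conj_by G (inv g) n = e x" by (rule e_surj)
  have "conj_by G n m = conj_by G g (conj_by G (conj_by G (inv g) n) (f i s))"
    using s g n by (simp add: G.conj_by_comp) (simp add: conj_by_def G.m_assoc[symmetric])
  also have "\<dots> = conj_by G g (f i (conj_by S (x i) s))"
    using x s i by (simp add: e_conj_f)
  finally show "conj_by G n m \<in> conj_by G g ` F i" using x s i by blast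
qed

text \<open>Containment is used in both directions. The factor found inside the conjugate of
  \<open>F j\<close> by \<open>inv g\<close> lies in \<open>F i\<close>, so it equals
  \<open>F i\<close>, and this reverses the first inclusion.\<close>

lemma conj_F:
  assumes g: "g \<in> carrier G" and i: "i < k"
  shows "\<exists>j<k. conj_by G g ` F i = F j"
proof -
  obtain j where j: "j < k" "F j \<subseteq> conj_by G g ` F i" using conj_F_contains[OF assms] by metis
  obtain l where l: "l < k" "F l \<subseteq> conj_by G (inv g) ` F j"
    using conj_F_contains[OF G.inv_closed[OF g] j(1)] by metis
  have "conj_by G (inv g) ` F j \<subseteq> F i"
    using image_mono[OF j(2), of "conj_by G (inv g)"] g by (simp add: G.conj_by_image_inv_cancel image_subset_iff)
  then have "F i \<subseteq> conj_by G (inv g) ` F j" using F_inj[OF l(1) i] l(2) by blast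
  then have "conj_by G g ` F i \<subseteq> F j"
    using image_mono[of _ _ "conj_by G g"] g G.conj_by_image_inv_cancel(2)[of g "F j"]
    by (metis f_closed image_subsetI)
  then show ?thesis using j by blast
qed

section \<open>The permutation of the factors and the induced automorphisms\<close>

definition \<sigma> :: "'g \<Rightarrow> nat \<Rightarrow> nat"
  where "\<sigma> g i = (SOME j. j < k \<and> conj_by G g ` F i = F j)"

lemma
  assumes "g \<in> carrier G" "i < k"
  shows \<sigma>_less [simp, intro]: "\<sigma> g i < k" and conj_F_eq: "conj_by G g ` F i = F (\<sigma> g i)"
proof -
  have *: "\<sigma> g i < k \<and> conj_by G g ` F i = F (\<sigma> g i)"
    unfolding \<sigma>_def by (rule someI_ex[OF conj_F[OF assms]])
  show "\<sigma> g i < k" by (rule conjunct1[OF *])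
  show "conj_by G g ` F i = F (\<sigma> g i)" by (rule conjunct2[OF *])
qed

lemma \<sigma>_eqI: "g \<in> carrier G \<Longrightarrow> i < k \<Longrightarrow> j < k \<Longrightarrow> conj_by G g ` F i = F j \<Longrightarrow> \<sigma> g i = j"
  by (rule F_inj) (simp_all add: conj_F_eq[symmetric])

text \<open>Together, \<open>\<sigma> g\<close> and the maps \<open>aut g i\<close> are the
  coordinates of g in the wreath product of Aut(S) with the symmetric group; the product rule there
  is \<open>\<sigma>_mult\<close> and \<open>aut_mult\<close>.\<close>

definition aut :: "'g \<Rightarrow> nat \<Rightarrow> 's \<Rightarrow> 's"
  where "aut g i = (\<lambda>s\<in>carrier S. inv_into (carrier S) (f (\<sigma> g i)) (conj_by G g (f i s)))"

lemma
  assumes "g \<in> carrier G" "i < k" "s \<in> carrier S"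
  shows aut_closed [simp, intro]: "aut g i s \<in> carrier S"
    and conj_f: "conj_by G g (f i s) = f (\<sigma> g i) (aut g i s)"
proof -
  have *: "conj_by G g (f i s) \<in> F (\<sigma> g i)" using conj_F_eq[OF assms(1,2)] assms(3) by blast
  show "aut g i s \<in> carrier S" using inv_into_into[OF *] assms by (simp add: aut_def)
  show "conj_by G g (f i s) = f (\<sigma> g i) (aut g i s)"
    using f_inv_into_f[OF *] assms by (simp add: aut_def)
qed

lemma aut_eqI:
  "g \<in> carrier G \<Longrightarrow> i < k \<Longrightarrow> s \<in> carrier S \<Longrightarrow> t \<in> carrier S \<Longrightarrow>
    conj_by G g (f i s) = f (\<sigma> g i) t \<Longrightarrow> aut g i s = t"
  using f_eq_iff[of "\<sigma> g i" "aut g i s" t] by (simp add: conj_f)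

lemma \<sigma>_mult:
  assumes g: "g \<in> carrier G" and h: "h \<in> carrier G" and i: "i < k"
  shows "\<sigma> (g \<otimes> h) i = \<sigma> g (\<sigma> h i)"
proof (rule \<sigma>_eqI)
  have "conj_by G (g \<otimes> h) ` F i = conj_by G g ` conj_by G h ` F i"
    using g h by (intro G.conj_by_image_comp[symmetric]) auto
  then show "conj_by G (g \<otimes> h) ` F i = F (\<sigma> g (\<sigma> h i))"
    using g h i by (simp only: conj_F_eq \<sigma>_less)
qed (use g h i in simp_all)

lemma aut_mult:
  assumes g: "g \<in> carrier G" and h: "h \<in> carrier G" and i: "i < k" and s: "s \<in> carrier S"
  shows "aut (g \<otimes> h) i s = aut g (\<sigma> h i) (aut h i s)"
proof (rule aut_eqI)
  have "conj_by G (g \<otimes> h) (f i s) = conj_by G g (conj_by G h (f i s))"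
    using g h s by (simp add: G.conj_by_comp)
  also have "\<dots> = f (\<sigma> (g \<otimes> h) i) (aut g (\<sigma> h i) (aut h i s))"
    using g h i s by (simp add: conj_f \<sigma>_mult)
  finally show "conj_by G (g \<otimes> h) (f i s) = f (\<sigma> (g \<otimes> h) i) (aut g (\<sigma> h i) (aut h i s))" .
qed (use g h i s in simp_all)

lemma \<sigma>_e [simp]: "x \<in> P \<Longrightarrow> i < k \<Longrightarrow> \<sigma> (e x) i = i"
proof (rule \<sigma>_eqI)
  assume x: "x \<in> P" and i: "i < k"
  have "conj_by G (e x) ` F i = f i ` conj_by S (x i) ` carrier S"
    unfolding image_image by (rule image_cong) (use x i in \<open>simp_all add: e_conj_f\<close>)
  also have "conj_by S (x i) ` carrier S = carrier S"
    using P_apply[OF x i] by (intro S.conj_by_image_self S.subgroup_self)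
  finally show "conj_by G (e x) ` F i = F i" .
qed auto

lemma aut_e [simp]: "x \<in> P \<Longrightarrow> i < k \<Longrightarrow> s \<in> carrier S \<Longrightarrow> aut (e x) i s = conj_by S (x i) s"
  by (rule aut_eqI) (simp_all add: e_conj_f P_apply[of x i])

lemma one_in_P: "(\<lambda>i\<in>{..<k}. \<one>\<^bsub>S\<^esub>) \<in> P"
  by simp

lemma \<sigma>_one [simp]: "i < k \<Longrightarrow> \<sigma> \<one> i = i"
  using \<sigma>_e[OF one_in_P] e_one by simp

lemma aut_one [simp]: "i < k \<Longrightarrow> s \<in> carrier S \<Longrightarrow> aut \<one> i s = s"
  using aut_e[OF one_in_P, of i s] e_one by simp

lemma \<sigma>_inv [simp]:
  "g \<in> carrier G \<Longrightarrow> i < k \<Longrightarrow> \<sigma> (inv g) (\<sigma> g i) = i"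
  "g \<in> carrier G \<Longrightarrow> i < k \<Longrightarrow> \<sigma> g (\<sigma> (inv g) i) = i"
  by (simp_all add: \<sigma>_mult[symmetric])

lemma aut_inv [simp]:
  "g \<in> carrier G \<Longrightarrow> i < k \<Longrightarrow> s \<in> carrier S \<Longrightarrow> aut (inv g) (\<sigma> g i) (aut g i s) = s"
  by (simp add: aut_mult[symmetric])

lemma aut_inv' [simp]:
  "g \<in> carrier G \<Longrightarrow> i < k \<Longrightarrow> s \<in> carrier S \<Longrightarrow> aut g (\<sigma> (inv g) i) (aut (inv g) i s) = s"
  by (simp add: aut_mult[symmetric])

lemma aut_auto:
  assumes g: "g \<in> carrier G" and i: "i < k"
  shows "aut g i \<in> auto S"
proof -
  have "aut g i \<in> hom S S"
  proof (rule homI)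
    fix s t assume s: "s \<in> carrier S" and t: "t \<in> carrier S"
    show "aut g i (s \<otimes>\<^bsub>S\<^esub> t) = aut g i s \<otimes>\<^bsub>S\<^esub> aut g i t"
      using g i s t by (intro aut_eqI) (auto simp: f_mult G.conj_by_mult conj_f)
  qed (use g i in auto)
  moreover have "bij_betw (aut g i) (carrier S) (carrier S)"
  proof (rule bij_betwI[where g = "aut (inv g) (\<sigma> g i)"])
    show "aut g i (aut (inv g) (\<sigma> g i) y) = y" if "y \<in> carrier S" for y
      using aut_inv'[of g "\<sigma> g i" y] that g i by simp
  qed (use g i in auto)
  moreover have "aut g i \<in> extensional (carrier S)" by (simp add: aut_def)
  ultimately show ?thesis by (simp add: auto_def Bij_def)
qed

lemma aut_image_mult:
  "g \<in> carrier G \<Longrightarrow> h \<in> carrier G \<Longrightarrow> i < k \<Longrightarrow> H \<subseteq> carrier S \<Longrightarrow>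
    aut (g \<otimes> h) i ` H = aut g (\<sigma> h i) ` aut h i ` H"
  unfolding image_image by (rule image_cong) (auto simp: aut_mult)

lemma aut_image_e:
  "x \<in> P \<Longrightarrow> i < k \<Longrightarrow> H \<subseteq> carrier S \<Longrightarrow> aut (e x) i ` H = conj_by S (x i) ` H"
  by (rule image_cong) auto

lemma conj_by_S_eqD:
  assumes "c \<in> carrier S" "d \<in> carrier S" "\<And>t. t \<in> carrier S \<Longrightarrow> conj_by S c t = conj_by S d t"
  shows "c = d"
  using S.simple_conj_by_inj[OF S.is_simple_group S_not_comm assms] by blast

text \<open>An element of \<open>N\<close> is determined by the automorphisms that it induces on the factors, since
  these have trivial centre. This avoids writing it as a product of elements of the factors.\<close>

lemma conj_e:
  assumes g: "g \<in> carrier G" and x: "x \<in> P"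
  obtains y where "y \<in> P" "conj_by G g (e x) = e y" "\<And>i. i < k \<Longrightarrow> y (\<sigma> g i) = aut g i (x i)"
proof -
  obtain y where y: "y \<in> P" "conj_by G g (e x) = e y" by (rule e_surj[OF N_conj[OF g e_closed[OF x]]])
  have "y (\<sigma> g i) = aut g i (x i)" if i: "i < k" for i
  proof (rule conj_by_S_eqD)
    fix t assume "t \<in> carrier S"
    then obtain s where s: "s \<in> carrier S" "t = aut g i s"
      using auto_surj[OF aut_auto[OF g i]] by blast
    have "f (\<sigma> g i) (conj_by S (aut g i (x i)) t) = conj_by G g (conj_by G (e x) (f i s))"
      using s g x i by (simp add: e_conj_f conj_f P_apply S.auto_conj_by[OF aut_auto])
    also have "\<dots> = conj_by G (e y) (conj_by G g (f i s))"
      unfolding y(2)[symmetric] using s g x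
      by (simp add: G.conj_by_comp) (simp add: conj_by_def G.m_assoc)
    also have "\<dots> = f (\<sigma> g i) (conj_by S (y (\<sigma> g i)) t)"
      using s g y(1) i by (simp add: conj_f e_conj_f)
    finally show "conj_by S (y (\<sigma> g i)) t = conj_by S (aut g i (x i)) t"
      using s g x y(1) i by (simp add: f_eq_iff P_apply)
  qed (use g x y i in \<open>simp_all add: P_apply\<close>)
  with y show ?thesis using that by blast
qed

text \<open>The product of the factors in one orbit is a nontrivial normal subgroup of G inside N,
  hence equal to N. Here Q is the orbit of i, and T consists of the tuples supported on Q.\<close>

lemma transitive:
  assumes i: "i < k" and j: "j < k"
  shows "\<exists>g\<in>carrier G. \<sigma> g i = j"
proof (rule ccontr)
  assume no: "\<not> ?thesis"
  define Q where "Q = {\<sigma> g i |g. g \<in> carrier G}"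
  define T where "T = {x \<in> P. \<forall>l<k. l \<notin> Q \<longrightarrow> x l = \<one>\<^bsub>S\<^esub>}"
  have TP: "x \<in> P" if "x \<in> T" for x using that by (simp add: T_def)
  have "subgroup (e ` T) G"
  proof (rule G.subgroupI)
    show "e ` T \<subseteq> carrier G" using TP by blast
    have "(\<lambda>i\<in>{..<k}. \<one>\<^bsub>S\<^esub>) \<in> T" by (simp add: T_def)
    then show "e ` T \<noteq> {}" by blast
  next
    fix a assume "a \<in> e ` T"
    then obtain x where x: "x \<in> T" "a = e x" by blast
    then have "(\<lambda>i\<in>{..<k}. inv\<^bsub>S\<^esub> x i) \<in> T" by (simp add: T_def PiE_iff)
    then show "inv a \<in> e ` T" unfolding x(2) e_inv[OF TP[OF x(1)]] by (rule imageI)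
  next
    fix a b assume "a \<in> e ` T" "b \<in> e ` T"
    then obtain x y where xy: "x \<in> T" "a = e x" "y \<in> T" "b = e y" by blast
    then have "(\<lambda>i\<in>{..<k}. x i \<otimes>\<^bsub>S\<^esub> y i) \<in> T" by (simp add: T_def PiE_iff)
    then show "a \<otimes> b \<in> e ` T" unfolding xy(2,4) e_mult[OF TP[OF xy(1)] TP[OF xy(3)]] by (rule imageI)
  qed
  moreover have "g \<otimes> n \<otimes> inv g \<in> e ` T" if g: "g \<in> carrier G" and n: "n \<in> e ` T" for g n
  proof -
    from n obtain x where x: "x \<in> T" "n = e x" by blast
    obtain y where y: "y \<in> P" "conj_by G g (e x) = e y" "\<And>l. l < k \<Longrightarrow> y (\<sigma> g l) = aut g l (x l)"
      by (rule conj_e[OF g TP[OF x(1)]]) blast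
    have "y l = \<one>\<^bsub>S\<^esub>" if l: "l < k" "l \<notin> Q" for l
    proof -
      \<comment> \<open>The complement of an orbit is invariant as well, so coordinate l of the
        conjugate comes from a trivial coordinate.\<close>
      have "\<sigma> (inv g) l \<notin> Q"
      proof
        assume "\<sigma> (inv g) l \<in> Q"
        then obtain h where h: "h \<in> carrier G" "\<sigma> (inv g) l = \<sigma> h i" by (auto simp: Q_def)
        then have "l = \<sigma> (g \<otimes> h) i" using g l i by (metis \<sigma>_mult \<sigma>_inv(2))
        then show False using l g h(1) by (auto simp: Q_def)
      qed
      then have "x (\<sigma> (inv g) l) = \<one>\<^bsub>S\<^esub>" using x g l by (simp add: T_def)
      then have "y l = aut g (\<sigma> (inv g) l) \<one>\<^bsub>S\<^esub>" using y(3)[of "\<sigma> (inv g) l"] g l by simp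
      also have "\<dots> = \<one>\<^bsub>S\<^esub>" using g l by (intro aut_eqI) simp_all
      finally show ?thesis .
    qed
    then have "y \<in> T" using y(1) by (simp add: T_def)
    then show ?thesis using x y(2) by (simp add: conj_by_def)
  qed
  ultimately have "e ` T \<lhd> G" by (simp add: G.normal_inv_iff)
  moreover have "e ` T \<subseteq> N" using TP by blast
  ultimately have T: "e ` T = {\<one>} \<or> e ` T = N"
    using N_minimal by (simp add: unique_minimal_normal_subgroup_def minimal_normal_subgroup_def)
  obtain s where s: "s \<in> carrier S" "s \<noteq> \<one>\<^bsub>S\<^esub>" by (rule S_nontrivial)
  have "i \<in> Q" using \<sigma>_one[OF i] G.one_closed unfolding Q_def by force
  then have "inj_at i s \<in> T" using s by (auto simp: T_def)
  moreover have "f i s \<noteq> \<one>" using s i by (metis f_eq_iff f_one S.one_closed)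
  ultimately have "e ` T = N" using T by (metis f_eq image_eqI singletonD)
  then obtain x where x: "x \<in> T" "e x = e (inj_at j s)" using s by (metis f_N f_eq imageE)
  then have "x = inj_at j s" using s TP by (simp add: e_eq_iff)
  then have "x j = s" using j by simp
  moreover have "j \<notin> Q" using no by (auto simp: Q_def)
  ultimately show False using x s j by (simp add: T_def)
qed

end

section \<open>The maximal subgroup attached to a stable class\<close>

lemma (in group) Inn_eq: "Inn G = (\<lambda>g. \<lambda>h\<in>carrier G. conj_by G g h) ` carrier G"
  by (simp add: Inn_def conj_by_def)

lemma (in group) Inn_auto: "Inn G \<subseteq> auto G"
proof
  fix \<alpha> assume "\<alpha> \<in> Inn G"
  then obtain g where g: "g \<in> carrier G" "\<alpha> = (\<lambda>h\<in>carrier G. conj_by G g h)" by (auto simp: Inn_eq)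
  have "bij_betw \<alpha> (carrier G) (carrier G)"
    by (rule bij_betwI[where g = "conj_by G (inv g)"]) (use g in auto)
  then show "\<alpha> \<in> auto G" using g by (auto simp: auto_def Bij_def conj_by_mult intro!: homI)
qed

lemma AutoGroup_mult:
  "\<alpha> \<in> auto S \<Longrightarrow> \<beta> \<in> auto S \<Longrightarrow> \<alpha> \<otimes>\<^bsub>AutoGroup S\<^esub> \<beta> = compose (carrier S) \<alpha> \<beta>"
  by (simp add: AutoGroup_def BijGroup_def auto_def)

context simple_power_socle
begin

lemma N_generated:
  assumes M: "subgroup M G" and F: "\<And>i. i < k \<Longrightarrow> F i \<subseteq> M"
  shows "N \<subseteq> M"
proof -
  interpret M: subgroup M G by fact
  \<comment> \<open>Induction on the length j of the initial segment supporting x, splitting off the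
    last coordinate each time; j = k is the claim.\<close>
  have "e x \<in> M" if "j \<le> k" "x \<in> P" "\<forall>i<k. j \<le> i \<longrightarrow> x i = \<one>\<^bsub>S\<^esub>" for j x
    using that
  proof (induction j arbitrary: x)
    case 0
    then have "x = (\<lambda>i\<in>{..<k}. \<one>\<^bsub>S\<^esub>)" by (intro P_eqI) simp_all
    then show ?case by (simp only: e_one M.one_closed)
  next
    case (Suc j)
    let ?y = "\<lambda>i\<in>{..<k}. if i = j then \<one>\<^bsub>S\<^esub> else x i"
    have y: "?y \<in> P" using Suc.prems by (simp add: PiE_iff)
    have xj: "x j \<in> carrier S" using Suc.prems by (simp add: P_apply)
    have "x = (\<lambda>i\<in>{..<k}. ?y i \<otimes>\<^bsub>S\<^esub> inj_at j (x j) i)"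
      using Suc.prems y xj by (intro P_eqI) (simp_all add: PiE_iff)
    then have "e x = e ?y \<otimes> f j (x j)"
      using e_mult[OF y inj_at_in[OF xj, of j]] by (simp add: f_eq)
    moreover have "e ?y \<in> M" by (rule Suc.IH[OF _ y]) (use Suc.prems in simp_all)
    moreover have "f j (x j) \<in> M" using F[of j] Suc.prems xj by auto
    ultimately show ?case by simp
  qed
  from this[of k] show ?thesis by (metis e_surj linorder_not_le order_refl subsetI)
qed

text \<open>Taking the identity at 0 makes \<open>spread V 0\<close> equal to V itself rather than
  to some image of V.\<close>

definition mover :: "nat \<Rightarrow> 'g"
  where "mover i = (if i = 0 then \<one> else SOME g. g \<in> carrier G \<and> \<sigma> g 0 = i)"

lemma
  assumes "i < k"
  shows mover_closed [simp, intro]: "mover i \<in> carrier G" and \<sigma>_mover [simp]: "\<sigma> (mover i) 0 = i"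
proof -
  have "mover i \<in> carrier G \<and> \<sigma> (mover i) 0 = i"
  proof (cases "i = 0")
    case False
    then show ?thesis
      unfolding mover_def using someI_ex[OF transitive[OF k_pos assms, unfolded Bex_def]] by simp
  qed (simp add: mover_def k_pos)
  then show "mover i \<in> carrier G" "\<sigma> (mover i) 0 = i" by auto
qed

text \<open>For an X-stable class another choice of \<open>mover i\<close> replaces this subgroup by
  an S-conjugate only, because two choices differ by an element fixing factor 0, which induces an
  automorphism in X.\<close>

definition spread :: "'s set \<Rightarrow> nat \<Rightarrow> 's set"
  where "spread V i = aut (mover i) 0 ` V"

text \<open>The normalizer in \<open>G\<close> of the product of the \<open>spread V i\<close>, described factor by factor so that no
  products inside \<open>N\<close> have to be formed.\<close>

definition spread_normalizer :: "'s set \<Rightarrow> 'g set"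
  where "spread_normalizer V = {g \<in> carrier G. \<forall>i<k. aut g i ` spread V i = spread V (\<sigma> g i)}"

lemma spread_0 [simp]: "V \<subseteq> carrier S \<Longrightarrow> spread V 0 = V"
  using k_pos by (force simp: spread_def mover_def subset_iff)

lemma spread_subset: "V \<subseteq> carrier S \<Longrightarrow> i < k \<Longrightarrow> spread V i \<subseteq> carrier S"
  using k_pos by (auto simp: spread_def)

lemma card_spread: "V \<subseteq> carrier S \<Longrightarrow> i < k \<Longrightarrow> card (spread V i) = card V"
  unfolding spread_def using k_pos
  by (intro card_image inj_on_subset[OF auto_inj_on[OF aut_auto]]) auto

lemma aut_hom: "g \<in> carrier G \<Longrightarrow> i < k \<Longrightarrow> group_hom S S (aut g i)"
  using aut_auto by (intro group_hom.intro group_hom_axioms.intro) (simp_all add: auto_def)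

lemma subgroup_spread: "subgroup V S \<Longrightarrow> i < k \<Longrightarrow> subgroup (spread V i) S"
  unfolding spread_def using k_pos by (intro group_hom.subgroup_img_is_subgroup[OF aut_hom]) auto

lemma subgroup_spread_normalizer:
  assumes V: "V \<subseteq> carrier S"
  shows "subgroup (spread_normalizer V) G"
proof (rule G.subgroupI)
  have "\<one> \<in> spread_normalizer V"
    using spread_subset[OF V] by (force simp: spread_normalizer_def subset_iff)
  then show "spread_normalizer V \<noteq> {}" by blast
next
  fix a assume a: "a \<in> spread_normalizer V"
  then have aG: "a \<in> carrier G" by (simp add: spread_normalizer_def)
  have "aut (inv a) i ` spread V i = spread V (\<sigma> (inv a) i)" if i: "i < k" for i
  proof -
    let ?j = "\<sigma> (inv a) i"
    have j: "?j < k" using aG i by simp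
    have "aut a ?j ` spread V ?j = spread V i" using a i aG j by (simp add: spread_normalizer_def)
    then have "aut (inv a) i ` spread V i = aut (inv a \<otimes> a) ?j ` spread V ?j"
      using aut_image_mult[of "inv a" a ?j "spread V ?j"] aG i j spread_subset[OF V j] by simp
    also have "\<dots> = spread V ?j" using spread_subset[OF V j] aG j by (force simp: subset_iff)
    finally show ?thesis .
  qed
  then show "inv a \<in> spread_normalizer V" using aG by (simp add: spread_normalizer_def)
next
  fix a b assume "a \<in> spread_normalizer V" "b \<in> spread_normalizer V"
  then show "a \<otimes> b \<in> spread_normalizer V"
    using spread_subset[OF V] by (simp add: spread_normalizer_def aut_image_mult \<sigma>_mult)
qed (auto simp: spread_normalizer_def)

end

section \<open>Automorphisms of S realized in the coordinate closure\<close>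

locale socle_with_closure = simple_power_socle +
  fixes X :: "('a \<Rightarrow> 'a) set"
  assumes X_subgroup: "subgroup X (AutoGroup S)"
    and Inn_X: "Inn S \<subseteq> X"
    and X_closure: "coordinate_closure S G k e = X"
begin

lemma X_auto: "X \<subseteq> auto S"
  using subgroup.subset[OF X_subgroup] by (simp add: AutoGroup_def)

lemma stabilizer_iff:
  "g \<in> stabilizer G (conj_subgroup G) (F 0) \<longleftrightarrow> g \<in> carrier G \<and> \<sigma> g 0 = 0"
proof -
  have "\<sigma> g 0 = 0 \<longleftrightarrow> conj_by G g ` F 0 = F 0" if "g \<in> carrier G"
    using \<sigma>_eqI[OF that k_pos k_pos] conj_F_eq[OF that k_pos] by metis
  then show ?thesis by (auto simp: stabilizer_def conj_subgroup_image)
qed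

lemma induced_aut_eq: "\<sigma> g 0 = 0 \<Longrightarrow> induced_aut S G (f 0) g = aut g 0"
  by (simp add: induced_aut_def aut_def conj_by_def)

lemma X_eq: "X = (\<lambda>g. aut g 0) ` {g \<in> carrier G. \<sigma> g 0 = 0} <#>\<^bsub>AutoGroup S\<^esub> Inn S"
proof -
  have "induced_aut S G (f 0) ` stabilizer G (conj_subgroup G) (F 0) =
      (\<lambda>g. aut g 0) ` {g \<in> carrier G. \<sigma> g 0 = 0}"
    by (rule image_cong) (auto simp: stabilizer_iff induced_aut_eq)
  then show ?thesis using X_closure by (simp add: coordinate_closure_def Let_def)
qed

lemma aut_in_X:
  assumes g: "g \<in> carrier G" "\<sigma> g 0 = 0"
  shows "aut g 0 \<in> X"
proof -
  \<comment> \<open>The identity, written as an inner automorphism to match the product that defines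
    the closure.\<close>
  let ?i = "\<lambda>h\<in>carrier S. conj_by S \<one>\<^bsub>S\<^esub> h"
  have i: "?i \<in> Inn S" by (auto simp: S.Inn_eq)
  have "aut g 0 \<otimes>\<^bsub>AutoGroup S\<^esub> ?i \<in> X"
    unfolding X_eq set_mult_def using g i by blast
  moreover have "aut g 0 \<otimes>\<^bsub>AutoGroup S\<^esub> ?i = aut g 0"
    using i S.Inn_auto aut_auto[OF g(1) k_pos]
    by (subst AutoGroup_mult) (auto simp: compose_def aut_def intro!: restrict_ext)
  ultimately show ?thesis by simp
qed

text \<open>The inner part of an element of X is induced by an element of factor 0 itself, so
  multiplying by that element realizes the whole automorphism inside G.\<close>

lemma X_realized:
  assumes "\<alpha> \<in> X"
  obtains g where "g \<in> carrier G" "\<sigma> g 0 = 0" "\<And>s. s \<in> carrier S \<Longrightarrow> \<alpha> s = aut g 0 s"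
proof -
  obtain g \<beta> where g: "g \<in> carrier G" "\<sigma> g 0 = 0" "\<beta> \<in> Inn S"
      "\<alpha> = aut g 0 \<otimes>\<^bsub>AutoGroup S\<^esub> \<beta>"
    using assms unfolding X_eq set_mult_def by blast
  obtain r where r: "r \<in> carrier S" "\<beta> = (\<lambda>h\<in>carrier S. conj_by S r h)" using g(3) by (auto simp: S.Inn_eq)
  have "\<alpha> = compose (carrier S) (aut g 0) \<beta>"
    unfolding g(4) using g S.Inn_auto aut_auto[OF g(1) k_pos] by (intro AutoGroup_mult) auto
  then have "\<alpha> s = aut (g \<otimes> f 0 r) 0 s" if "s \<in> carrier S" for s
    using that g(1) r k_pos by (simp add: aut_mult f_eq compose_def)
  moreover have "\<sigma> (g \<otimes> f 0 r) 0 = 0" using g r k_pos by (simp add: \<sigma>_mult f_eq)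
  ultimately show ?thesis using that[of "g \<otimes> f 0 r"] g r by simp
qed

end

section \<open>The subgroup attached to one saturating class\<close>

locale saturating_class = socle_with_closure S G N k e X
  for S :: "('s, 'm) monoid_scheme" and G :: "('g, 'n) monoid_scheme" (structure) and N k e X +
  fixes V :: "'s set"
  assumes V_subgroup: "subgroup V S"
    and V_proper: "V \<noteq> carrier S"
    and V_self_normalizing: "normalizer S V = V"
    and V_stable: "class_stable S X V"
    and V_maximal: "\<And>R. subgroup R S \<Longrightarrow> V \<subseteq> R \<Longrightarrow> R \<noteq> carrier S \<Longrightarrow> normalizer S R = R \<Longrightarrow>
      class_stable S X R \<Longrightarrow> R = V"
    and V_saturating: "normally_saturating S V"
begin

lemma V_subset: "V \<subseteq> carrier S"
  by (rule subgroup.subset[OF V_subgroup])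

abbreviation D :: "nat \<Rightarrow> 's set"
  where "D \<equiv> spread V"

abbreviation A :: "'g set"
  where "A \<equiv> spread_normalizer V"

lemma D_subset: "i < k \<Longrightarrow> D i \<subseteq> carrier S"
  by (rule spread_subset[OF V_subset])

lemma subgroup_D: "i < k \<Longrightarrow> subgroup (D i) S"
  by (rule subgroup_spread[OF V_subgroup])

lemma subgroup_A: "subgroup A G"
  by (rule subgroup_spread_normalizer[OF V_subset])

lemma A_closed: "a \<in> A \<Longrightarrow> a \<in> carrier G"
  by (simp add: spread_normalizer_def)

lemma A_image: "a \<in> A \<Longrightarrow> i < k \<Longrightarrow> aut a i ` D i = D (\<sigma> a i)"
  by (simp add: spread_normalizer_def)

text \<open>Pulling both factors back to factor 0 turns g into \<open>?h\<close>, which fixes factor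
  0 and so induces an element of X. Stability of V supplies a conjugating element, and
  \<open>mover ?j\<close> carries it to factor \<open>?j\<close>.\<close>

lemma spread_stable:
  assumes g: "g \<in> carrier G" and i: "i < k"
  shows "\<exists>s\<in>carrier S. aut g i ` D i = conj_by S s ` D (\<sigma> g i)"
proof -
  let ?j = "\<sigma> g i"
  let ?h = "inv (mover ?j) \<otimes> (g \<otimes> mover i)"
  have j: "?j < k" using g i by simp
  have "\<sigma> (inv (mover ?j)) (\<sigma> (mover ?j) 0) = 0" by (rule \<sigma>_inv(1)) (simp_all add: j k_pos)
  then have h: "?h \<in> carrier G" "\<sigma> ?h 0 = 0" using g i j k_pos by (simp_all add: \<sigma>_mult)
  then obtain s where s: "s \<in> carrier S" "aut ?h 0 ` V = conj_by S s ` V"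
    using V_stable aut_in_X[OF h] by (auto simp: class_stable_def S.conj_class_iff)
  have "g \<otimes> mover i = mover ?j \<otimes> ?h"
    using g i j by (simp add: G.m_assoc[symmetric])
  then have "aut g i ` D i = aut (mover ?j \<otimes> ?h) 0 ` V"
    unfolding spread_def using aut_image_mult[OF g mover_closed[OF i] k_pos V_subset] i by simp
  also have "\<dots> = aut (mover ?j) 0 ` conj_by S s ` V"
    using aut_image_mult[OF mover_closed[OF j] h(1) k_pos V_subset] h(2) s(2) by simp
  also have "\<dots> = conj_by S (aut (mover ?j) 0 s) ` D ?j"
    unfolding spread_def
    by (rule S.auto_conj_by_image[OF aut_auto[OF mover_closed[OF j] k_pos] s(1) V_subset])
  finally show ?thesis using s(1) j k_pos by blast
qed

text \<open>A Frattini argument: g moves the family D to an S-conjugate family in every coordinate,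
  and one element of N undoes all these conjugations at once.\<close>

lemma frattini:
  assumes g: "g \<in> carrier G"
  obtains x a where "x \<in> P" "a \<in> A" "g = e x \<otimes> a"
proof -
  \<comment> \<open>Indexing by the target j, reached from \<open>\<sigma> (inv g) j\<close>, lets
    the conjugating elements be collected into the single tuple \<open>?x\<close>.\<close>
  have "\<exists>s. s \<in> carrier S \<and> aut g (\<sigma> (inv g) j) ` D (\<sigma> (inv g) j) = conj_by S s ` D j" if "j < k" for j
    using spread_stable[OF g, of "\<sigma> (inv g) j"] that g by auto
  then obtain s where s: "\<And>j. j < k \<Longrightarrow> s j \<in> carrier S"
      "\<And>j. j < k \<Longrightarrow> aut g (\<sigma> (inv g) j) ` D (\<sigma> (inv g) j) = conj_by S (s j) ` D j"
    by metis
  let ?x = "\<lambda>j\<in>{..<k}. s j" and ?y = "\<lambda>j\<in>{..<k}. inv\<^bsub>S\<^esub> (s j)"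
  have x: "?x \<in> P" and y: "?y \<in> P" using s(1) by (simp_all add: PiE_iff)
  have inv: "inv (e ?x) = e ?y"
    using e_inv[OF x] by (simp cong: restrict_cong)
  have "aut (e ?y \<otimes> g) i ` D i = D (\<sigma> (e ?y \<otimes> g) i)" if i: "i < k" for i
  proof -
    let ?j = "\<sigma> g i"
    have j: "?j < k" using g i by simp
    have "aut (e ?y \<otimes> g) i ` D i = aut (e ?y) ?j ` aut g i ` D i"
      by (rule aut_image_mult[OF e_in_carrier[OF y] g i D_subset[OF i]])
    also have "aut g i ` D i = conj_by S (s ?j) ` D ?j" using s(2)[OF j] g i by simp
    also have "aut (e ?y) ?j ` \<dots> = conj_by S (?y ?j) ` conj_by S (s ?j) ` D ?j"
      by (rule aut_image_e[OF y j S.conj_by_image_subset_carrier[OF s(1)[OF j] D_subset[OF j]]])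
    also have "\<dots> = D ?j"
      using S.conj_by_image_inv_cancel(1)[OF s(1)[OF j] D_subset[OF j]] j by simp
    also have "?j = \<sigma> (e ?y \<otimes> g) i" using y g i by (simp add: \<sigma>_mult del: restrict_apply)
    finally show ?thesis .
  qed
  then have "e ?y \<otimes> g \<in> A" using y g by (simp add: spread_normalizer_def del: restrict_apply)
  moreover have "g = e ?x \<otimes> (e ?y \<otimes> g)"
    unfolding inv[symmetric] using e_in_carrier[OF x] g by (simp add: G.m_assoc[symmetric] del: restrict_apply)
  ultimately show ?thesis using that x by blast
qed

text \<open>N fixes every factor, so the A-part of \<open>mover j\<close> moves factor 0 to the same
  place. Unlike an arbitrary such element, it carries V exactly to \<open>D j\<close>.\<close>

lemma A_transitive:
  assumes j: "j < k"
  obtains a where "a \<in> A" "\<sigma> a 0 = j" "aut a 0 ` V = D j"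
proof -
  obtain x a where xa: "x \<in> P" "a \<in> A" "mover j = e x \<otimes> a" by (rule frattini[OF mover_closed[OF j]])
  have "j = \<sigma> (e x \<otimes> a) 0" using \<sigma>_mover[OF j] unfolding xa(3) by simp
  also have "\<dots> = \<sigma> a 0" using xa A_closed k_pos by (simp add: \<sigma>_mult)
  finally have "\<sigma> a 0 = j" by simp
  then show ?thesis using that[OF xa(2)] A_image[OF xa(2) k_pos] V_subset by simp
qed

text \<open>An element of N acts on each factor by conjugation with its coordinate, so it lies in A
  iff each coordinate normalizes \<open>D i\<close>. Self-normalization of V, transported by an
  element of A, turns this into membership.\<close>

lemma e_in_A_iff:
  assumes x: "x \<in> P"
  shows "e x \<in> A \<longleftrightarrow> (\<forall>i<k. x i \<in> D i)"
proof
  assume "\<forall>i<k. x i \<in> D i"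
  then show "e x \<in> A"
    using x by (simp add: spread_normalizer_def aut_image_e D_subset S.conj_by_image_self subgroup_D)
next
  assume A: "e x \<in> A"
  show "\<forall>i<k. x i \<in> D i"
  proof (intro allI impI)
    fix i assume i: "i < k"
    obtain a where a: "a \<in> A" "\<sigma> a 0 = i" "aut a 0 ` V = D i" by (rule A_transitive[OF i])
    have auto: "aut a 0 \<in> auto S" using a A_closed k_pos by (simp add: aut_auto)
    obtain s where s: "s \<in> carrier S" "x i = aut a 0 s"
      using auto_surj[OF auto] P_apply[OF x i] by (metis imageE)
    have "aut a 0 ` conj_by S s ` V = conj_by S (x i) ` D i"
      unfolding S.auto_conj_by_image[OF auto s(1) V_subset] a(3) s(2) ..
    also have "\<dots> = aut a 0 ` V"
      using A_image[OF A i] x i a(3) by (simp add: aut_image_e D_subset)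
    finally have "conj_by S s ` V = V"
      using inj_on_image_eq_iff[OF auto_inj_on[OF auto]] s(1) V_subset
      by (simp add: S.conj_by_image_subset_carrier)
    then have "s \<in> normalizer S V" using S.normalizer_iff[OF V_subset] s(1) by blast
    then have "s \<in> V" by (simp only: V_self_normalizing)
    then show "x i \<in> D i" using a(3) s(2) by blast
  qed
qed

lemma A_inter_N: "A \<inter> N = e ` (\<Pi>\<^sub>E i\<in>{..<k}. D i)"
proof -
  have "x \<in> (\<Pi>\<^sub>E i\<in>{..<k}. D i) \<longleftrightarrow> x \<in> P \<and> (\<forall>i<k. x i \<in> D i)" for x
    using D_subset by (auto simp: PiE_iff)
  then show ?thesis using e_in_A_iff by (auto elim!: e_surj)
qed

lemma card_A_inter_N: "card (A \<inter> N) = card V ^ k"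
proof -
  have "(\<Pi>\<^sub>E i\<in>{..<k}. D i) \<subseteq> P" using D_subset by (intro PiE_mono) auto
  then have "inj_on e (\<Pi>\<^sub>E i\<in>{..<k}. D i)"
    using e_bij by (auto simp: bij_betw_def intro: inj_on_subset)
  then show ?thesis
    using V_subset by (simp add: A_inter_N card_image card_PiE card_spread)
qed

lemma card_A: "card A * card N = order G * card V ^ k"
proof -
  have "N <#> A = carrier G"
  proof
    show "N <#> A \<subseteq> carrier G" using A_closed by (auto simp: set_mult_def)
    show "carrier G \<subseteq> N <#> A"
    proof
      fix g assume g: "g \<in> carrier G"
      show "g \<in> N <#> A" by (rule frattini[OF g]) (auto simp: set_mult_def)
    qed
  qed
  then show ?thesis
    using G.card_set_mult[OF N.subgroup_axioms subgroup_A G_finite]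
    by (simp add: order_def card_A_inter_N Int_commute[of N A] mult.commute[of "card A"])
qed

lemma A_proper: "A \<noteq> carrier G"
proof
  assume A: "A = carrier G"
  have "s \<in> V" if "s \<in> carrier S" for s
  proof -
    have "e (inj_at 0 s) \<in> A" using that A by simp
    then have "inj_at 0 s 0 \<in> D 0" using k_pos e_in_A_iff[OF inj_at_in[OF that]] by blast
    then show ?thesis using k_pos V_subset by simp
  qed
  then show False using V_proper V_subset by blast
qed

lemma f_0_in_A: assumes v: "v \<in> V" shows "f 0 v \<in> A"
proof -
  have vS: "v \<in> carrier S" using v V_subset by blast
  have "inj_at 0 v i \<in> D i" if "i < k" for i
    using that v V_subset subgroup.one_closed[OF subgroup_D[OF that]] by (cases "i = 0") simp_all
  then show ?thesis unfolding f_eq using e_in_A_iff[OF inj_at_in[OF vS]] by blast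
qed

lemma maximal_A: "maximal_subgroup A G"
  unfolding maximal_subgroup_def
proof (intro conjI allI impI subgroup_A A_proper)
  fix M assume M: "subgroup M G" and AM: "A \<subseteq> M"
  interpret M: subgroup M G by fact
  have M_conj: "conj_by G m n \<in> M" if "m \<in> M" "n \<in> M" for m n
    using that by (simp add: conj_by_def)
  \<comment> \<open>All projections of M \<inter> N are introduced, not only the one to factor 0: M
    permutes them, and this is how its elements are later recognized as members of A.\<close>
  define R where "R i = {x i |x. x \<in> P \<and> e x \<in> M}" for i
  have R_subset: "R i \<subseteq> carrier S" if "i < k" for i
    using that P_apply by (auto simp: R_def)
  have R_le: "aut m i ` R i \<subseteq> R (\<sigma> m i)" if m: "m \<in> M" and i: "i < k" for m i
  proof
    fix t assume "t \<in> aut m i ` R i"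
    then obtain x where x: "x \<in> P" "e x \<in> M" "t = aut m i (x i)" by (auto simp: R_def)
    obtain y where y: "y \<in> P" "conj_by G m (e x) = e y" "\<And>i. i < k \<Longrightarrow> y (\<sigma> m i) = aut m i (x i)"
      by (rule conj_e[OF M.mem_carrier[OF m] x(1)]) blast
    have "e y \<in> M" using M_conj[OF m x(2)] y(2) by simp
    then have "y (\<sigma> m i) \<in> R (\<sigma> m i)" using y(1) unfolding R_def by blast
    then show "t \<in> R (\<sigma> m i)" using y(3)[OF i] x(3) by simp
  qed
  have R_aut: "aut m i ` R i = R (\<sigma> m i)" if m: "m \<in> M" and i: "i < k" for m i
  proof
    have mG: "m \<in> carrier G" using m by simp
    have j: "\<sigma> m i < k" using mG i by simp
    have "R (\<sigma> m i) = aut m i ` aut (inv m) (\<sigma> m i) ` R (\<sigma> m i)"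
      using aut_inv'[OF mG j] R_subset[OF j] mG i by (force simp: subset_iff image_iff)
    also have "\<dots> \<subseteq> aut m i ` R i"
      using R_le[OF M.m_inv_closed[OF m] j] mG i by (intro image_mono) simp
    finally show "R (\<sigma> m i) \<subseteq> aut m i ` R i" .
  qed (rule R_le[OF m i])
  have R_subgroup: "subgroup (R 0) S"
  proof (rule S.subgroupI)
    show "R 0 \<subseteq> carrier S" by (rule R_subset[OF k_pos])
    have "e (\<lambda>i\<in>{..<k}. \<one>\<^bsub>S\<^esub>) \<in> M" by (simp only: e_one M.one_closed)
    then show "R 0 \<noteq> {}" using one_in_P unfolding R_def by blast
  next
    fix a assume "a \<in> R 0"
    then obtain x where x: "x \<in> P" "e x \<in> M" "a = x 0" by (auto simp: R_def)
    let ?y = "\<lambda>i\<in>{..<k}. inv\<^bsub>S\<^esub> x i"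
    have "?y \<in> P" using x(1) by (simp add: PiE_iff)
    moreover have "e ?y \<in> M" using M.m_inv_closed[OF x(2)] e_inv[OF x(1)] by simp
    moreover have "inv\<^bsub>S\<^esub> a = ?y 0" using x k_pos by simp
    ultimately show "inv\<^bsub>S\<^esub> a \<in> R 0" unfolding R_def by blast
  next
    fix a b assume "a \<in> R 0" "b \<in> R 0"
    then obtain x y where x: "x \<in> P" "e x \<in> M" "a = x 0" and y: "y \<in> P" "e y \<in> M" "b = y 0"
      by (auto simp: R_def)
    let ?z = "\<lambda>i\<in>{..<k}. x i \<otimes>\<^bsub>S\<^esub> y i"
    have "?z \<in> P" using x(1) y(1) by (simp add: PiE_iff)
    moreover have "e ?z \<in> M" using M.m_closed[OF x(2) y(2)] e_mult[OF x(1) y(1)] by simp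
    moreover have "a \<otimes>\<^bsub>S\<^esub> b = ?z 0" using x y k_pos by simp
    ultimately show "a \<otimes>\<^bsub>S\<^esub> b \<in> R 0" unfolding R_def by blast
  qed
  have VR: "V \<subseteq> R 0"
  proof
    fix v assume v: "v \<in> V"
    have "inj_at 0 v \<in> P" using v V_subset by (intro inj_at_in) blast
    moreover have "e (inj_at 0 v) \<in> M" using f_0_in_A[OF v] AM unfolding f_eq by blast
    moreover have "v = inj_at 0 v 0" using k_pos by simp
    ultimately show "v \<in> R 0" unfolding R_def by blast
  qed
  have fR: "f 0 ` R 0 \<subseteq> M"
  proof -
    let ?T = "{s \<in> carrier S. f 0 s \<in> M}"
    have "subgroup ?T S"
      by (rule S.subgroupI) (auto simp: f_inv f_mult intro: exI[of _ "\<one>\<^bsub>S\<^esub>"])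
    \<comment> \<open>Conjugating \<open>f 0 v\<close> by \<open>e x\<close> involves only the
      coordinate \<open>x 0\<close>. Thus M already contains, inside factor 0, every conjugate of V
      under \<open>R 0\<close>, although \<open>e x\<close> itself need not lie in that
      factor.\<close>
    moreover have "(\<Union>w\<in>R 0. conj_subgroup S w V) \<subseteq> ?T"
    proof
      fix t assume "t \<in> (\<Union>w\<in>R 0. conj_subgroup S w V)"
      then obtain x v where xv: "x \<in> P" "e x \<in> M" "v \<in> V" "t = conj_by S (x 0) v"
        by (auto simp: conj_subgroup_image R_def)
      then have "conj_by G (e x) (f 0 v) \<in> M" using f_0_in_A AM M_conj by blast
      then show "t \<in> ?T" using xv V_subset k_pos P_apply[OF xv(1) k_pos] by (auto simp: e_conj_f)
    qed
    ultimately have "normal_closure S (R 0) V \<subseteq> ?T"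
      unfolding normal_closure_def by (intro S.generate_subgroup_incl)
    then show ?thesis using V_saturating R_subgroup VR by (auto simp: normally_saturating_def)
  qed
  text \<open>Normal saturation is used twice: in \<open>fR\<close>, to find in \<open>M\<close> the whole projection \<open>R 0\<close> of
    \<open>M \<inter> N\<close>, and here, to see that the class of \<open>R 0\<close> belongs to the poset.\<close>
  have R_normalizer: "normalizer S (R 0) = R 0"
  proof
    let ?Q = "normalizer S (R 0)"
    have R0: "R 0 \<subseteq> carrier S" by (rule R_subset[OF k_pos])
    show RQ: "R 0 \<subseteq> ?Q"
      using S.normalizer_iff[OF R0] S.conj_by_image_self[OF R_subgroup] R0 by blast
    \<comment> \<open>An element normalizing \<open>R 0\<close> keeps V inside \<open>R 0\<close>,
      so the normal closure of V in \<open>?Q\<close>, which is \<open>?Q\<close> itself, stays in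
      \<open>R 0\<close>.\<close>
    have "(\<Union>w\<in>?Q. conj_subgroup S w V) \<subseteq> R 0"
      using S.normalizer_iff[OF R0] VR by (auto simp: conj_subgroup_image)
    then have "normal_closure S ?Q V \<subseteq> R 0"
      unfolding normal_closure_def by (intro S.generate_subgroup_incl R_subgroup)
    then show "?Q \<subseteq> R 0"
      using V_saturating S.normalizer_imp_subgroup[OF R0] VR RQ unfolding normally_saturating_def by blast
  qed
  \<comment> \<open>An automorphism in X comes from some g = \<open>e x \<otimes> a\<close>. The
    part a lies in M and fixes factor 0, so it preserves \<open>R 0\<close>; the part
    \<open>e x\<close> acts there as an inner automorphism.\<close>
  have R_stable: "class_stable S X (R 0)"
    unfolding class_stable_def
  proof
    fix \<alpha> assume "\<alpha> \<in> X"
    then obtain g where g: "g \<in> carrier G" "\<sigma> g 0 = 0" "\<And>s. s \<in> carrier S \<Longrightarrow> \<alpha> s = aut g 0 s"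
      by (rule X_realized) blast
    obtain x a where xa: "x \<in> P" "a \<in> A" "g = e x \<otimes> a" by (rule frattini[OF g(1)])
    have a0: "\<sigma> a 0 = 0" using g(2) xa A_closed k_pos by (simp add: \<sigma>_mult)
    have "\<alpha> ` R 0 = aut g 0 ` R 0" using g(3) R_subset[OF k_pos] by (intro image_cong) auto
    also have "\<dots> = aut (e x) 0 ` aut a 0 ` R 0"
      unfolding xa(3) using aut_image_mult[OF _ A_closed[OF xa(2)] k_pos R_subset[OF k_pos], of "e x"] xa(1) a0
      by simp
    also have "aut a 0 ` R 0 = R 0" using R_aut[of a 0] xa(2) AM k_pos a0 by auto
    also have "aut (e x) 0 ` R 0 = conj_by S (x 0) ` R 0" by (rule aut_image_e[OF xa(1) k_pos R_subset[OF k_pos]])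
    finally show "\<alpha> ` R 0 \<in> conj_class S (R 0)"
      using P_apply[OF xa(1) k_pos] by (auto simp: S.conj_class_iff)
  qed
  show "M = A \<or> M = carrier G"
  proof (cases "R 0 = carrier S")
    case True
    \<comment> \<open>M contains factor 0 by \<open>fR\<close>, and A, which lies in M, moves it to
      every other factor.\<close>
    have "F i \<subseteq> M" if i: "i < k" for i
    proof
      fix y assume "y \<in> F i"
      then obtain t where t: "t \<in> carrier S" "y = f i t" by blast
      obtain a where a: "a \<in> A" "\<sigma> a 0 = i" by (rule A_transitive[OF i])
      have aG: "a \<in> carrier G" using a A_closed by blast
      obtain s where s: "s \<in> carrier S" "t = aut a 0 s"
        using auto_surj[OF aut_auto[OF aG k_pos]] t by (metis imageE)
      have "conj_by G a (f 0 s) \<in> M" using a AM s True fR by (intro M_conj) auto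
      then show "y \<in> M" using conj_f[OF aG k_pos s(1)] a t s by simp
    qed
    then have "N \<subseteq> M" by (rule N_generated[OF M])
    have "g \<in> M" if g: "g \<in> carrier G" for g
    proof -
      obtain x a where xa: "x \<in> P" "a \<in> A" "g = e x \<otimes> a" by (rule frattini[OF g])
      have "e x \<in> M" "a \<in> M" using \<open>N \<subseteq> M\<close> AM e_closed[OF xa(1)] xa(2) by blast+
      then show ?thesis unfolding xa(3) by (rule M.m_closed)
    qed
    then show ?thesis using M.subset by blast
  next
    case False
    then have R0: "R 0 = V" by (rule V_maximal[OF R_subgroup VR _ R_normalizer R_stable])
    \<comment> \<open>Elements of A carry both V and \<open>R 0\<close> to coordinate i, so the
      equality at 0 spreads. Then M permutes the subgroups \<open>D i\<close>, which is the
      condition defining A.\<close>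
    have R: "R i = D i" if i: "i < k" for i
    proof -
      obtain a where a: "a \<in> A" "\<sigma> a 0 = i" "aut a 0 ` V = D i" by (rule A_transitive[OF i])
      then show ?thesis using R_aut[of a 0] AM k_pos R0 by auto
    qed
    have "m \<in> A" if m: "m \<in> M" for m
      using R_aut[OF m] M.mem_carrier[OF m] by (simp add: spread_normalizer_def R)
    then show ?thesis using AM by blast
  qed
qed

end

section \<open>The index of the socle\<close>

text \<open>On a finite set the bijections are the injective self-maps, which are counted by a
  falling factorial.\<close>

lemma order_BijGroup:
  assumes "finite A"
  shows "order (BijGroup A) = fact (card A)"
proof -
  have "f \<in> Bij A \<longleftrightarrow> f \<in> A \<rightarrow>\<^sub>E A \<and> inj_on f A" for f
    using endo_inj_surj[OF assms, of f]
    by (auto simp: Bij_def bij_betw_def PiE_iff image_subset_iff)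
  then have "Bij A = {f \<in> A \<rightarrow>\<^sub>E A. inj_on f A}" by blast
  then show ?thesis
    using card_inj_on_subset_funcset[OF assms assms subset_refl]
    by (simp add: order_def BijGroup_def fact_prod_rev)
qed

text \<open>A nontrivial normal subgroup of least order inside C is minimal normal, hence equal to
  N.\<close>

lemma (in group) unique_minimal_normal_subgroup_least:
  assumes N: "unique_minimal_normal_subgroup N G" and C: "C \<lhd> G" "C \<noteq> {\<one>}" and fin: "finite (carrier G)"
  shows "N \<subseteq> C"
proof -
  let ?Q = "\<lambda>M. M \<lhd> G \<and> M \<noteq> {\<one>} \<and> M \<subseteq> C"
  obtain M where M: "?Q M" "\<And>M'. ?Q M' \<Longrightarrow> card M \<le> card M'"
    using ex_has_least_nat[of ?Q C card] C by blast
  have "M' = M" if "M' \<lhd> G" "M' \<subseteq> M" "M' \<noteq> {\<one>}" for M'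
  proof (rule card_subset_eq)
    have "M \<subseteq> carrier G" using M(1) by (intro subgroup.subset normal_imp_subgroup) simp
    then show fM: "finite M" using fin by (rule finite_subset)
    have "M' \<subseteq> C" using that(2) M(1) by blast
    then have "card M \<le> card M'" using that by (intro M(2)) simp
    then show "card M' = card M" using card_mono[OF fM that(2)] by simp
  qed (rule that(2))
  then have "minimal_normal_subgroup M G" using M(1) by (auto simp: minimal_normal_subgroup_def)
  then show ?thesis using N M(1) by (auto simp: unique_minimal_normal_subgroup_def)
qed

section \<open>Inner automorphisms as a normal subgroup of X\<close>

context group
begin

definition inner :: "'a \<Rightarrow> 'a \<Rightarrow> 'a"
  where "inner g = (\<lambda>h\<in>carrier G. conj_by G g h)"

lemma inner_Inn: "g \<in> carrier G \<Longrightarrow> inner g \<in> Inn G"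
  by (auto simp: Inn_eq inner_def)

lemma Inn_inner: "\<alpha> \<in> Inn G \<Longrightarrow> \<exists>g\<in>carrier G. \<alpha> = inner g"
  by (auto simp: Inn_eq inner_def)

lemma normal_Inn:
  assumes X: "subgroup X (AutoGroup G)" and Inn_X: "Inn G \<subseteq> X"
  shows "Inn G \<lhd> (AutoGroup G)\<lparr>carrier := X\<rparr>"
proof -
  let ?X = "(AutoGroup G)\<lparr>carrier := X\<rparr>"
  interpret X: group ?X by (rule group.subgroup_imp_group[OF AutoGroup X])
  have auto: "X \<subseteq> auto G" using subgroup.subset[OF X] by (simp add: AutoGroup_def)
  have mult: "\<alpha> \<otimes>\<^bsub>?X\<^esub> \<beta> = compose (carrier G) \<alpha> \<beta>" if "\<alpha> \<in> X" "\<beta> \<in> X" for \<alpha> \<beta>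
    using that auto AutoGroup_mult[of \<alpha> G \<beta>] by auto
  have "group_hom G ?X inner"
  proof (intro group_hom.intro group_hom_axioms.intro homI)
    fix g h assume gh: "g \<in> carrier G" "h \<in> carrier G"
    then have "inner g \<in> X" "inner h \<in> X" using inner_Inn Inn_X by auto
    then show "inner (g \<otimes> h) = inner g \<otimes>\<^bsub>?X\<^esub> inner h"
      unfolding mult[OF \<open>inner g \<in> X\<close> \<open>inner h \<in> X\<close>] using gh
      by (auto simp: inner_def compose_def conj_by_comp intro!: restrict_ext)
  qed (use inner_Inn Inn_X in \<open>auto intro: X.is_group is_group\<close>)
  moreover have "inner ` carrier G = Inn G" using inner_Inn Inn_inner by blast
  ultimately have "subgroup (Inn G) ?X" by (metis group_hom.img_is_subgroup)
  moreover have "\<alpha> \<otimes>\<^bsub>?X\<^esub> \<beta> \<otimes>\<^bsub>?X\<^esub> inv\<^bsub>?X\<^esub> \<alpha> \<in> Inn G" if \<alpha>: "\<alpha> \<in> X" and \<beta>: "\<beta> \<in> Inn G" for \<alpha> \<beta>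
  proof -
    obtain g where g: "g \<in> carrier G" "\<beta> = inner g" using Inn_inner[OF \<beta>] by blast
    have a: "\<alpha> \<in> auto G" using \<alpha> auto by blast
    let ?\<gamma> = "inner (\<alpha> g)"
    have \<gamma>: "?\<gamma> \<in> Inn G" using auto_closed[OF a g(1)] by (rule inner_Inn)
    \<comment> \<open>The identity that conjugating inner g by \<alpha> gives inner (\<alpha> g),
      stated as a commutation rule so that the inverse of \<alpha> need not be computed as a
      map.\<close>
    have "\<alpha> \<otimes>\<^bsub>?X\<^esub> \<beta> = ?\<gamma> \<otimes>\<^bsub>?X\<^esub> \<alpha>"
      unfolding mult[OF \<alpha> subsetD[OF Inn_X \<beta>]] mult[OF subsetD[OF Inn_X \<gamma>] \<alpha>]
      unfolding compose_def
      by (rule restrict_ext) (simp add: g inner_def auto_conj_by[OF a] auto_closed[OF a])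
    then have "\<alpha> \<otimes>\<^bsub>?X\<^esub> \<beta> \<otimes>\<^bsub>?X\<^esub> inv\<^bsub>?X\<^esub> \<alpha> = ?\<gamma>"
    proof (rule ssubst)
      have "\<alpha> \<in> carrier ?X" "?\<gamma> \<in> carrier ?X" using \<alpha> \<gamma> Inn_X by auto
      then show "?\<gamma> \<otimes>\<^bsub>?X\<^esub> \<alpha> \<otimes>\<^bsub>?X\<^esub> inv\<^bsub>?X\<^esub> \<alpha> = ?\<gamma>"
        by (simp only: X.m_assoc X.inv_closed X.r_inv X.r_one)
    qed
    then show ?thesis using \<gamma> by simp
  qed
  ultimately show ?thesis by (auto simp: X.normal_inv_iff)
qed

end

context simple_power_socle
begin

text \<open>The elements satisfying the hypotheses form the centralizer of \<open>N\<close>, a normal subgroup of \<open>G\<close>;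
  if it were nontrivial it would contain \<open>N\<close>, and \<open>N\<close> would be abelian.\<close>

lemma faithful:
  assumes g: "g \<in> carrier G" "\<And>i. i < k \<Longrightarrow> \<sigma> g i = i"
    "\<And>i s. i < k \<Longrightarrow> s \<in> carrier S \<Longrightarrow> aut g i s = s"
  shows "g = \<one>"
proof (rule ccontr)
  assume "g \<noteq> \<one>"
  define C where "C = {g \<in> carrier G. \<forall>i<k. \<sigma> g i = i \<and> (\<forall>s\<in>carrier S. aut g i s = s)}"
  have C_D: "c \<in> carrier G" "i < k \<Longrightarrow> \<sigma> c i = i" "i < k \<Longrightarrow> s \<in> carrier S \<Longrightarrow> aut c i s = s"
    if "c \<in> C" for c i s
    using that by (simp_all add: C_def)
  have "subgroup C G"
  proof (rule G.subgroupI)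
    have "\<one> \<in> C" by (simp add: C_def)
    then show "C \<noteq> {}" by blast
  next
    fix a assume a: "a \<in> C"
    have "\<sigma> (inv a) i = i" "s \<in> carrier S \<Longrightarrow> aut (inv a) i s = s" if i: "i < k" for i s
      using \<sigma>_inv(1)[OF C_D(1)[OF a] i] aut_inv[OF C_D(1)[OF a] i, of s] C_D[OF a] i by simp_all
    then show "inv a \<in> C" using C_D(1)[OF a] by (simp add: C_def)
  next
    fix a b assume "a \<in> C" "b \<in> C"
    then show "a \<otimes> b \<in> C" by (simp add: C_def \<sigma>_mult aut_mult)
  qed (auto simp: C_def)
  moreover have "x \<otimes> c \<otimes> inv x \<in> C" if x: "x \<in> carrier G" and c: "c \<in> C" for x c
    using x C_D[OF c] by (simp add: C_def \<sigma>_mult aut_mult)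
  ultimately have "C \<lhd> G" by (simp add: G.normal_inv_iff)
  moreover have "g \<in> C" using g by (simp add: C_def)
  ultimately have NC: "N \<subseteq> C"
    using G.unique_minimal_normal_subgroup_least[OF N_minimal _ _ G_finite] \<open>g \<noteq> \<one>\<close> by blast
  obtain s where s: "s \<in> carrier S" "s \<noteq> \<one>\<^bsub>S\<^esub>" by (rule S_nontrivial)
  have "e (inj_at 0 s) \<in> C" using NC e_closed[OF inj_at_in[OF s(1)]] by blast
  then have "conj_by S s t = conj_by S \<one>\<^bsub>S\<^esub> t" if "t \<in> carrier S" for t
    using C_D(3)[of "e (inj_at 0 s)" 0 t] that s k_pos by simp
  then show False using conj_by_S_eqD[of s "\<one>\<^bsub>S\<^esub>"] s by blast
qed

lemma aut_mult_compose:
  assumes "g \<in> carrier G" "h \<in> carrier G" "i < k"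
  shows "aut (g \<otimes> h) i = compose (carrier S) (aut g (\<sigma> h i)) (aut h i)"
proof (rule extensionalityI[where A = "carrier S"])
  show "aut (g \<otimes> h) i \<in> extensional (carrier S)" by (simp add: aut_def)
qed (use assms in \<open>simp_all add: aut_mult compose_def\<close>)

definition factor_kernel :: "'g set"
  where "factor_kernel = {g \<in> carrier G. \<forall>i<k. \<sigma> g i = i}"

text \<open>The permutation action on the k factors is a homomorphism to a group of order k! with
  this kernel.\<close>

lemma order_dvd_factor_kernel:
  shows "subgroup factor_kernel G" and "order G dvd fact k * card factor_kernel"
proof -
  let ?\<rho> = "\<lambda>g. \<lambda>i\<in>{..<k}. \<sigma> g i"
  have Bij: "?\<rho> g \<in> Bij {..<k}" if g: "g \<in> carrier G" for g
    using bij_betwI[of "?\<rho> g" "{..<k}" "{..<k}" "\<sigma> (inv g)"] g by (simp add: Bij_def)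
  interpret \<rho>: group_hom G "BijGroup {..<k}" ?\<rho>
  proof (intro group_hom.intro group_hom_axioms.intro homI)
    show "?\<rho> g \<in> carrier (BijGroup {..<k})" if "g \<in> carrier G" for g
      using Bij[OF that] by (simp add: BijGroup_def)
    show "?\<rho> (g \<otimes> h) = ?\<rho> g \<otimes>\<^bsub>BijGroup {..<k}\<^esub> ?\<rho> h" if "g \<in> carrier G" "h \<in> carrier G" for g h
      using that Bij[of g] Bij[of h]
      by (simp add: BijGroup_def) (auto simp: compose_def \<sigma>_mult intro!: restrict_ext)
  qed (rule G.is_group group_BijGroup)+
  have "?\<rho> g = (\<lambda>i\<in>{..<k}. i) \<longleftrightarrow> (\<forall>i<k. \<sigma> g i = i)" for g
    by (auto simp: fun_eq_iff restrict_def)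
  then have K: "kernel G (BijGroup {..<k}) ?\<rho> = factor_kernel"
    by (simp add: kernel_def factor_kernel_def BijGroup_def)
  show "subgroup factor_kernel G" using \<rho>.subgroup_kernel unfolding K .
  show "order G dvd fact k * card factor_kernel"
    using \<rho>.order_dvd_card_kernel unfolding K by (simp add: order_BijGroup)
qed

end

context socle_with_closure
begin

text \<open>Elements fixing all factors map to the k-th power of X/Inn(S). An element of the kernel
  induces inner automorphisms on all factors; the element of N with the same action equals it by
  \<open>faithful\<close>, so the kernel lies in N.\<close>

lemma order_dvd:
  assumes x: "x = order ((AutoGroup S)\<lparr>carrier := X\<rparr> Mod Inn S)"
  shows "order G dvd fact k * (x ^ k * card N)"
proof -
  let ?X = "(AutoGroup S)\<lparr>carrier := X\<rparr>" and ?K = "G\<lparr>carrier := factor_kernel\<rparr>"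
  let ?Q = "product_group {..<k} (\<lambda>_. ?X Mod Inn S)"
  \<comment> \<open>Conjugating back by \<open>mover i\<close> reads the action of g on factor i as
    one on factor 0, where X is defined.\<close>
  let ?h = "\<lambda>g i. conj_by G (inv (mover i)) g"
  let ?\<tau> = "\<lambda>g. \<lambda>i\<in>{..<k}. Inn S #>\<^bsub>?X\<^esub> aut (?h g i) 0"
  interpret X: group ?X by (rule group.subgroup_imp_group[OF S.AutoGroup X_subgroup])
  interpret I: normal "Inn S" ?X by (rule S.normal_Inn[OF X_subgroup Inn_X])
  interpret Q: group "?X Mod Inn S" by (rule I.factorgroup_is_group)
  interpret K: subgroup factor_kernel G by (rule order_dvd_factor_kernel)
  have h: "?h g i \<in> carrier G" "\<sigma> (?h g i) 0 = 0" if "g \<in> factor_kernel" "i < k" for g i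
  proof -
    have m: "mover i \<in> carrier G" and g: "g \<in> carrier G" using that by simp_all
    show "?h g i \<in> carrier G" using m g by simp
    have gi: "\<sigma> g i = \<sigma> (mover i) 0"
      unfolding \<sigma>_mover[OF that(2)] using that unfolding factor_kernel_def by blast
    have "\<sigma> (?h g i) 0 = \<sigma> (inv (mover i)) (\<sigma> g i)"
      using m g that k_pos by (simp add: conj_by_def \<sigma>_mult)
    also have "\<dots> = 0" unfolding gi by (rule \<sigma>_inv(1)[OF m k_pos])
    finally show "\<sigma> (?h g i) 0 = 0" .
  qed
  have hX: "aut (?h g i) 0 \<in> X" if "g \<in> factor_kernel" "i < k" for g i
    using h[OF that] by (rule aut_in_X)
  interpret \<tau>: group_hom ?K ?Q ?\<tau>
  proof (intro group_hom.intro group_hom_axioms.intro homI)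
    show "group ?K" by (rule G.subgroup_imp_group) (rule K.subgroup_axioms)
    show "group ?Q" by simp
    show "?\<tau> g \<in> carrier ?Q" if "g \<in> carrier ?K" for g
      using hX that hom_in_carrier[OF I.r_coset_hom_Mod] by simp
    show "?\<tau> (g \<otimes>\<^bsub>?K\<^esub> g') = ?\<tau> g \<otimes>\<^bsub>?Q\<^esub> ?\<tau> g'" if "g \<in> carrier ?K" "g' \<in> carrier ?K" for g g'
    proof -
      have "Inn S #>\<^bsub>?X\<^esub> aut (?h (g \<otimes> g') i) 0 =
          (Inn S #>\<^bsub>?X\<^esub> aut (?h g i) 0) <#>\<^bsub>?X\<^esub> (Inn S #>\<^bsub>?X\<^esub> aut (?h g' i) 0)" if i: "i < k" for i
      proof -
        have gk: "g \<in> factor_kernel" "g' \<in> factor_kernel" using \<open>g \<in> carrier ?K\<close> \<open>g' \<in> carrier ?K\<close> by simp_all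
        have "?h (g \<otimes> g') i = ?h g i \<otimes> ?h g' i"
          using gk i by (intro G.conj_by_mult) simp_all
        then have "aut (?h (g \<otimes> g') i) 0 = compose (carrier S) (aut (?h g i) 0) (aut (?h g' i) 0)"
          using h[OF gk(1) i] h[OF gk(2) i] k_pos
          by (simp add: aut_mult_compose)
        also have "\<dots> = aut (?h g i) 0 \<otimes>\<^bsub>?X\<^esub> aut (?h g' i) 0"
          using hX[OF gk(1) i] hX[OF gk(2) i] X_auto by (simp add: AutoGroup_mult subset_iff)
        finally have eq: "aut (?h (g \<otimes> g') i) 0 = aut (?h g i) 0 \<otimes>\<^bsub>?X\<^esub> aut (?h g' i) 0" .
        show ?thesis
          unfolding eq by (rule I.rcos_sum[symmetric]) (simp_all add: hX[OF gk(1) i] hX[OF gk(2) i])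
      qed
      then show ?thesis by (auto simp: FactGroup_def intro!: restrict_ext)
    qed
  qed
  let ?L = "kernel ?K ?Q ?\<tau>"
  have L: "subgroup ?L G" by (rule G.incl_subgroup[OF K.subgroup_axioms \<tau>.subgroup_kernel])
  have "g \<in> N" if g: "g \<in> ?L" for g
  proof -
    have gK: "g \<in> factor_kernel" and gG: "g \<in> carrier G" using g subgroup.subset[OF L] by (auto simp: kernel_def)
    have "\<exists>y. y \<in> carrier S \<and> (\<forall>t\<in>carrier S. aut g i t = conj_by S y t)" if i: "i < k" for i
    proof -
      have m: "mover i \<in> carrier G" using i by simp
      have "?\<tau> g i = (\<lambda>i\<in>{..<k}. Inn S) i" using g by (simp add: kernel_def FactGroup_def)
      then have "Inn S #>\<^bsub>?X\<^esub> aut (?h g i) 0 = Inn S" using i by simp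
      then have "aut (?h g i) 0 \<in> Inn S"
        by (rule X.coset_join1) (use hX[OF gK i] I.subgroup_axioms in simp_all)
      then obtain r where r: "r \<in> carrier S" "aut (?h g i) 0 = S.inner r" using S.Inn_inner by blast
      have "aut g i t = conj_by S (aut (mover i) 0 r) t" if t: "t \<in> carrier S" for t
      proof -
        have a: "aut (mover i) 0 \<in> auto S" by (rule aut_auto[OF m k_pos])
        obtain s where s: "s \<in> carrier S" "t = aut (mover i) 0 s" using auto_surj[OF a] t by (metis imageE)
        \<comment> \<open>Undoing this translation: the automorphism on factor i is inner r
          conjugated by \<open>aut (mover i) 0\<close>, hence again inner.\<close>
        have "g \<otimes> mover i = mover i \<otimes> ?h g i"
          using m gG by (simp add: conj_by_def G.m_assoc[symmetric])
        then have "aut (g \<otimes> mover i) 0 s = aut (mover i \<otimes> ?h g i) 0 s" by simp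
        then have "aut g i t = aut (mover i) 0 (aut (?h g i) 0 s)"
          using aut_mult[OF gG m k_pos s(1)] aut_mult[OF m h(1)[OF gK i] k_pos s(1)] s h(2)[OF gK i] i by simp
        also have "\<dots> = aut (mover i) 0 (conj_by S r s)" using r(2) s by (simp add: S.inner_def)
        also have "\<dots> = conj_by S (aut (mover i) 0 r) t" using S.auto_conj_by[OF a r(1) s(1)] s by simp
        finally show ?thesis .
      qed
      then show ?thesis using r m k_pos by blast
    qed
    then obtain y where y: "\<And>i. i < k \<Longrightarrow> y i \<in> carrier S"
        "\<And>i t. i < k \<Longrightarrow> t \<in> carrier S \<Longrightarrow> aut g i t = conj_by S (y i) t"
      by metis
    let ?y = "\<lambda>i\<in>{..<k}. y i" and ?z = "\<lambda>i\<in>{..<k}. inv\<^bsub>S\<^esub> (y i)"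
    have yP: "?y \<in> P" and zP: "?z \<in> P" using y(1) by (simp_all add: PiE_iff)
    have inv: "inv (e ?y) = e ?z" using e_inv[OF yP] by (simp cong: restrict_cong)
    have \<sigma>g: "\<sigma> g i = i" if "i < k" for i using gK that unfolding factor_kernel_def by blast
    have "e ?z \<otimes> g = \<one>"
    proof (rule faithful)
      show "e ?z \<otimes> g \<in> carrier G" using e_in_carrier[OF zP] gG by simp
      show "\<sigma> (e ?z \<otimes> g) i = i" if "i < k" for i
        using \<sigma>_mult[OF e_in_carrier[OF zP] gG that] \<sigma>_e[OF zP that] \<sigma>g[OF that] by simp
      show "aut (e ?z \<otimes> g) i s = s" if "i < k" "s \<in> carrier S" for i s
        using aut_mult[OF e_in_carrier[OF zP] gG that] aut_e[OF zP that(1), of "aut g i s"] \<sigma>g[OF that(1)]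
          y that gG by simp
    qed
    then have "g = e ?y"
      unfolding inv[symmetric] using e_in_carrier[OF yP] gG by (metis G.inv_closed G.inv_equality G.inv_inv)
    then show ?thesis using e_closed[OF yP] by simp
  qed
  then have "?L \<subseteq> N" by blast
  then have "subgroup ?L (G\<lparr>carrier := N\<rparr>)" by (intro G.subgroup_incl L N.subgroup_axioms)
  then have "card ?L dvd order (G\<lparr>carrier := N\<rparr>)"
    using group.lagrange[OF G.subgroup_imp_group[OF N.subgroup_axioms]] dvd_triv_right by metis
  then have L_dvd: "card ?L dvd card N" by (simp add: order_def)
  have "order ?Q = card (carrier (?X Mod Inn S)) ^ k"
    unfolding order_def carrier_product_group by (subst card_PiE) simp_all
  then have "order ?Q = x ^ k" by (simp only: x order_def)
  moreover have "order ?K = card factor_kernel" by (simp add: order_def)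
  ultimately have "card factor_kernel dvd x ^ k * card ?L"
    using \<tau>.order_dvd_card_kernel by (simp only:)
  then have "card factor_kernel dvd x ^ k * card N"
    by (rule dvd_trans) (rule mult_dvd_mono[OF dvd_refl L_dvd])
  then have "fact k * card factor_kernel dvd fact k * (x ^ k * card N)"
    by (rule mult_dvd_mono[OF dvd_refl])
  with order_dvd_factor_kernel(2) show ?thesis by (rule dvd_trans)
qed

end

section \<open>Counting\<close>

context socle_with_closure
begin

text \<open>Valuations add only over nonzero factors, so x must be known to be positive before it
  enters the count.\<close>

lemma X_index_pos: "0 < order ((AutoGroup S)\<lparr>carrier := X\<rparr> Mod Inn S)"
proof -
  let ?X = "(AutoGroup S)\<lparr>carrier := X\<rparr>"
  interpret X: group ?X by (rule group.subgroup_imp_group[OF S.AutoGroup X_subgroup])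
  have "auto S \<subseteq> carrier S \<rightarrow>\<^sub>E carrier S" by (auto simp: auto_def hom_def Bij_def PiE_def)
  then have "finite X"
    using X_auto finite_PiE[of "carrier S" "\<lambda>_. carrier S"] S_finite by (meson finite_subset)
  then have "0 < order ?X" by (simp add: X.order_gt_0_iff_finite)
  then have "0 < card (rcosets\<^bsub>?X\<^esub> Inn S)"
    using X.lagrange[OF normal_imp_subgroup[OF S.normal_Inn[OF X_subgroup Inn_X]]] by (metis gr0I mult_is_0)
  then show ?thesis by (simp add: order_def FactGroup_def)
qed

end

context saturating_class
begin

lemma f_0_in_A_iff: "s \<in> carrier S \<Longrightarrow> f 0 s \<in> A \<longleftrightarrow> s \<in> V"
proof
  assume s: "s \<in> carrier S" and "f 0 s \<in> A"
  then have "inj_at 0 s 0 \<in> D 0" using e_in_A_iff[OF inj_at_in[OF s]] k_pos unfolding f_eq by blast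
  then show "s \<in> V" using k_pos V_subset by simp
qed (rule f_0_in_A)

text \<open>By \<open>frattini\<close> the conjugating element may be taken in N, as its A-part
  normalizes A. It then acts on factor 0 as conjugation by \<open>x 0\<close>, and the elements of
  factor 0 in the two subgroups recover V and W.\<close>

lemma not_conjugate:
  assumes W: "saturating_class S G N k e X W"
    and conj: "spread_normalizer W \<in> conj_class G A"
  shows "W \<in> conj_class S V"
proof -
  interpret W: saturating_class S G N k e X W by (rule W)
  obtain g where g: "g \<in> carrier G" "W.A = conj_by G g ` A"
    using conj by (auto simp: G.conj_class_iff)
  obtain x a where xa: "x \<in> P" "a \<in> A" "g = e x \<otimes> a" by (rule frattini[OF g(1)])
  have A_carrier: "A \<subseteq> carrier G" using A_closed by blast
  have eG: "e x \<in> carrier G" by (rule e_in_carrier[OF xa(1)])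
  have x0: "x 0 \<in> carrier S" by (rule P_apply[OF xa(1) k_pos])
  have "W.A = conj_by G (e x) ` conj_by G a ` A"
    unfolding g(2) xa(3) using G.conj_by_image_comp[OF eG A_closed[OF xa(2)] A_carrier] by simp
  then have WA: "W.A = conj_by G (e x) ` A" using G.conj_by_image_self[OF subgroup_A xa(2)] by simp
  have "conj_by S (x 0) s \<in> W \<longleftrightarrow> s \<in> V" if s: "s \<in> carrier S" for s
  proof -
    have "conj_by S (x 0) s \<in> W \<longleftrightarrow> conj_by G (e x) (f 0 s) \<in> W.A"
      using W.f_0_in_A_iff[of "conj_by S (x 0) s"] s x0 e_conj_f[OF xa(1) s k_pos] by simp
    also have "\<dots> \<longleftrightarrow> f 0 s \<in> A"
      unfolding WA using eG s A_carrier by (auto simp: subset_iff image_iff)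
    finally show ?thesis using f_0_in_A_iff[OF s] by simp
  qed
  note iff = this
  have "W = conj_by S (x 0) ` V"
  proof
    show "conj_by S (x 0) ` V \<subseteq> W" using iff V_subset by blast
    show "W \<subseteq> conj_by S (x 0) ` V"
    proof
      fix w assume w: "w \<in> W"
      then have wS: "w \<in> carrier S" using W.V_subset by blast
      have "conj_by S (inv\<^bsub>S\<^esub> x 0) w \<in> V"
        using iff[of "conj_by S (inv\<^bsub>S\<^esub> x 0) w"] w wS x0 by simp
      moreover have "w = conj_by S (x 0) (conj_by S (inv\<^bsub>S\<^esub> x 0) w)" using wS x0 by simp
      ultimately show "w \<in> conj_by S (x 0) ` V" by blast
    qed
  qed
  then show ?thesis using x0 by (auto simp: S.conj_class_iff)
qed

end

text \<open>Membership in the poset provides its conditions for some representative U only;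
  conjugation transfers them to the given V.\<close>

lemma (in group) stable_classes_conj:
  assumes V: "subgroup V G" and X: "X \<subseteq> auto G" and st: "conj_class G V \<in> stable_classes G X"
  shows "V \<noteq> {\<one>}" "V \<noteq> carrier G" "normalizer G V = V" "class_stable G X V"
proof -
  have VG: "V \<subseteq> carrier G" by (rule subgroup.subset[OF V])
  obtain U where U: "subgroup U G" "U \<noteq> {\<one>}" "U \<noteq> carrier G" "normalizer G U = U"
      "class_stable G X U" and UV: "conj_class G V = conj_class G U"
    using st unfolding stable_classes_def by blast
  have UG: "U \<subseteq> carrier G" by (rule subgroup.subset[OF U(1)])
  obtain s where s: "s \<in> carrier G" "V = conj_by G s ` U"
    using conj_class_self[OF VG] unfolding UV conj_class_iff by blast
  have US: "U = conj_by G (inv s) ` V" unfolding s(2) conj_by_image_inv_cancel(1)[OF s(1) UG] ..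
  show "V \<noteq> {\<one>}"
  proof
    assume "V = {\<one>}"
    then have "U = {\<one>}" using US s(1) by simp
    then show False using U(2) by contradiction
  qed
  show "V \<noteq> carrier G"
  proof
    assume "V = carrier G"
    then have "U = carrier G" using US conj_by_image_self[OF subgroup_self, of "inv s"] s(1) by simp
    then show False using U(3) by contradiction
  qed
  show "normalizer G V = V"
  proof
    show "V \<subseteq> normalizer G V"
      using normalizer_iff[OF VG] conj_by_image_self[OF V] VG by blast
    show "normalizer G V \<subseteq> V"
    proof
      fix g assume "g \<in> normalizer G V"
      then have g: "g \<in> carrier G" "conj_by G g ` V = V" using normalizer_iff[OF VG] by blast+
      let ?h = "conj_by G (inv s) g"
      have h: "?h = inv s \<otimes> g \<otimes> s" using s(1) by (simp add: conj_by_def)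
      have "conj_by G ?h ` U = conj_by G (inv s) ` conj_by G g ` conj_by G s ` U"
        using s(1) g(1) UG by (simp add: h conj_by_image_comp conj_by_image_subset_carrier m_assoc)
      also have "\<dots> = U" unfolding s(2)[symmetric] g(2) by (rule US[symmetric])
      finally have "?h \<in> normalizer G U" using normalizer_iff[OF UG] s(1) g(1) by simp
      then have "?h \<in> U" by (simp only: U(4))
      then have "conj_by G s ?h \<in> V" unfolding s(2) by (rule imageI)
      then show "g \<in> V" using s(1) g(1) by simp
    qed
  qed
  show "class_stable G X V"
    unfolding class_stable_def
  proof
    fix \<alpha> assume \<alpha>: "\<alpha> \<in> X"
    then have a: "\<alpha> \<in> auto G" using X by blast
    obtain t where t: "t \<in> carrier G" "\<alpha> ` U = conj_by G t ` U"
      using U(5) \<alpha> unfolding class_stable_def conj_class_iff by blast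
    have "\<alpha> ` V = conj_by G (\<alpha> s) ` \<alpha> ` U"
      unfolding s(2) by (rule auto_conj_by_image[OF a s(1) UG])
    then have "\<alpha> ` V = conj_by G (\<alpha> s \<otimes> t) ` U"
      unfolding t(2) conj_by_image_comp[OF auto_closed[OF a s(1)] t(1) UG] .
    then have "\<alpha> ` V \<in> conj_class G U"
      unfolding conj_class_iff using auto_closed[OF a s(1)] t(1) by blast
    then show "\<alpha> ` V \<in> conj_class G V" by (simp only: UV)
  qed
qed

text \<open>Maximality of the class makes R conjugate to V; since V lies in R and the orders are
  equal and finite, the two coincide.\<close>

lemma (in group) maximal_stable_classD:
  assumes V: "subgroup V G" and X: "X \<subseteq> auto G" and fin: "finite (carrier G)"
    and max: "maximal_stable_class G X (conj_class G V)"
    and R: "subgroup R G" "V \<subseteq> R" "R \<noteq> carrier G" "normalizer G R = R" "class_stable G X R"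
  shows "R = V"
proof -
  have VG: "V \<subseteq> carrier G" and RG: "R \<subseteq> carrier G"
    using subgroup.subset[OF V] subgroup.subset[OF R(1)] .
  have "V \<noteq> {\<one>}"
    using max stable_classes_conj(1)[OF V X] by (simp add: maximal_stable_class_def)
  then have "R \<noteq> {\<one>}" using R(2) subgroup.one_closed[OF V] by blast
  then have "conj_class G R \<in> stable_classes G X" using R unfolding stable_classes_def by blast
  moreover have "class_le G (conj_class G V) (conj_class G R)"
    unfolding class_le_iff[OF VG RG] using conj_subgroup_one[OF RG] R(2) one_closed by metis
  ultimately have "conj_class G R = conj_class G V" using max by (simp add: maximal_stable_class_def)
  then obtain g where "g \<in> carrier G" "R = conj_by G g ` V"
    using conj_class_self[OF RG] unfolding conj_class_iff[symmetric] by (auto simp: conj_class_iff)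
  then have "card R = card V" using card_conj_by_image[OF _ VG] by blast
  then show ?thesis
    using card_subset_eq[OF finite_subset[OF RG fin] R(2)] by simp
qed

theorem theorem4p1:
  fixes S :: "('s, 'm) monoid_scheme"
    and X :: "('s \<Rightarrow> 's) set"
    and V W :: "'s set"
    and p x :: nat
  assumes "simple_group S" and "finite (carrier S)" and "\<not> comm_group S"
    and "subgroup X (AutoGroup S)" and "Inn S \<subseteq> X"
    and "x = order ((AutoGroup S)\<lparr>carrier := X\<rparr> Mod Inn S)"
    and "subgroup V S" and "subgroup W S"
    and "conj_class S V \<noteq> conj_class S W"
    and "maximal_stable_class S X (conj_class S V)"
    and "maximal_stable_class S X (conj_class S W)"
    and "normally_saturating S V" and "normally_saturating S W"
    and "prime p"
    and "int (multiplicity p (order S)) - int (multiplicity p (card V))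
           - int (multiplicity p (card W)) > int (multiplicity p x)"
  shows "\<forall>k\<ge>2. \<not> (\<exists>(G :: ('g, 'n) monoid_scheme) N e.
           group G \<and> finite (carrier G) \<and>
           unique_minimal_normal_subgroup N G \<and>
           e \<in> iso (power_group S k) (G\<lparr>carrier := N\<rparr>) \<and>
           coordinate_closure S G k e = X \<and>
           property_P G)"
proof (intro allI impI notI)
  fix k :: nat
  assume k: "2 \<le> k" and "\<exists>(G :: ('g, 'n) monoid_scheme) N e.
           group G \<and> finite (carrier G) \<and>
           unique_minimal_normal_subgroup N G \<and>
           e \<in> iso (power_group S k) (G\<lparr>carrier := N\<rparr>) \<and>
           coordinate_closure S G k e = X \<and>
           property_P G"
  then obtain G :: "('g, 'n) monoid_scheme" and N e where G: "group G" "finite (carrier G)"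
      "unique_minimal_normal_subgroup N G" "e \<in> iso (power_group S k) (G\<lparr>carrier := N\<rparr>)"
      "coordinate_closure S G k e = X" and PG: "property_P G"
    by blast
  interpret S: simple_group S by fact
  interpret socle_with_closure S G N k e X
    using assms(1-5) G k
    by (intro socle_with_closure.intro simple_power_socle.intro simple_power_socle_axioms.intro
        socle_with_closure_axioms.intro) simp_all
  have sat: "saturating_class S G N k e X U"
    if "subgroup U S" "maximal_stable_class S X (conj_class S U)" "normally_saturating S U" for U
  proof (intro saturating_class.intro saturating_class_axioms.intro)
    have st: "conj_class S U \<in> stable_classes S X" using that(2) by (simp add: maximal_stable_class_def)
    show "U \<noteq> carrier S" "normalizer S U = U" "class_stable S X U"
      using S.stable_classes_conj(2-4)[OF that(1) X_auto st] .
    show "R = U" if "subgroup R S" "U \<subseteq> R" "R \<noteq> carrier S" "normalizer S R = R" "class_stable S X R" for R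
      using S.maximal_stable_classD[OF \<open>subgroup U S\<close> X_auto assms(2) \<open>maximal_stable_class S X (conj_class S U)\<close> that] .
  qed (use that socle_with_closure_axioms in simp_all)
  interpret V: saturating_class S G N k e X V using sat assms(7,10,12) .
  interpret W: saturating_class S G N k e X W using sat assms(8,11,13) .
  have "W.A \<notin> conj_class G V.A"
  proof
    assume "W.A \<in> conj_class G V.A"
    then have "W \<in> conj_class S V" by (rule V.not_conjugate[OF W.saturating_class_axioms])
    then obtain s where "s \<in> carrier S" "W = conj_by S s ` V" by (auto simp: S.conj_class_iff)
    then have "conj_class S W = conj_class S V" using S.conj_class_eqI[OF V.V_subset] by simp
    then show False using assms(9) by simp
  qed
  then have "V.A <#>\<^bsub>G\<^esub> W.A = carrier G"
    using PG V.maximal_A W.maximal_A by (simp add: property_P_def)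
  then have "order G * card (V.A \<inter> W.A) = card V.A * card W.A"
    using G.card_set_mult[OF V.subgroup_A W.subgroup_A G_finite] by (simp add: order_def)
  \<comment> \<open>The factor |N|^2 brings both orders into the form in which \<open>card_A\<close>
    evaluates them.\<close>
  then have "order G * (card (V.A \<inter> W.A) * card N ^ 2) = (card V.A * card N) * (card W.A * card N)"
    by (simp add: power2_eq_square ac_simps)
  also have "\<dots> = order G * (order G * (card V ^ k * card W ^ k))"
    unfolding V.card_A W.card_A by (simp add: ac_simps)
  finally have count: "card (V.A \<inter> W.A) * card N ^ 2 = order G * (card V ^ k * card W ^ k)"
    using G.order_gt_0_iff_finite G_finite by simp
  have pos: "0 < order G" "0 < order S" "0 < card V" "0 < card W" "0 < card (V.A \<inter> W.A)" "0 < x"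
  proof -
    show "0 < order G" "0 < order S" "0 < card V" "0 < card W"
      using G.order_gt_0_iff_finite G_finite S.order_gt_0_iff_finite S_finite
        subgroup.finite_imp_card_positive[OF V.V_subgroup] subgroup.finite_imp_card_positive[OF W.V_subgroup]
      by simp_all
    then show "0 < card (V.A \<inter> W.A)" using count by (metis gr0I mult_is_0 power_not_zero)
    show "0 < x"
      using X_index_pos by (simp add: assms(6))
  qed
  have cN: "card N = order S ^ k"
    using bij_betw_same_card[OF e_bij] by (simp add: card_PiE order_def)
  have pe: "prime_elem p" using \<open>prime p\<close> by simp
  note mult = prime_elem_multiplicity_mult_distrib[OF pe] prime_elem_multiplicity_power_distrib[OF pe]
  let ?v = "multiplicity p"
  \<comment> \<open>The valuation of the intersection is dropped, so only |N| = |S|^k remains on the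
    left.\<close>
  have "2 * (k * ?v (order S)) \<le> ?v (card (V.A \<inter> W.A) * card N ^ 2)"
    using pos by (simp add: mult cN)
  also have "\<dots> = ?v (order G) + (k * ?v (card V) + k * ?v (card W))"
    unfolding count using pos by (simp add: mult)
  finally have lower: "2 * (k * ?v (order S)) \<le> ?v (order G) + (k * ?v (card V) + k * ?v (card W))" .
  have "?v (order G) \<le> ?v (fact k * (x ^ k * card N))"
    using pos by (intro dvd_imp_multiplicity_le order_dvd[OF assms(6)]) (simp add: cN)
  also have "\<dots> = ?v (fact k) + (k * ?v x + k * ?v (order S))"
    using pos by (simp add: mult cN)
  finally have upper: "?v (order G) \<le> ?v (fact k) + (k * ?v x + k * ?v (order S))" .
  \<comment> \<open>Each of the k coordinates has a surplus of at least 1 by the strict hypothesis.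
    With the two bounds this makes the valuation of k! at least k.\<close>
  have "?v (card V) + ?v (card W) + ?v x + 1 \<le> ?v (order S)" using assms(15) by linarith
  then have "k * (?v (card V) + ?v (card W) + ?v x + 1) \<le> k * ?v (order S)" by (rule mult_le_mono2)
  then have "k \<le> ?v (fact k)" using lower upper by (simp add: algebra_simps)
  then show False using multiplicity_fact_less[OF \<open>prime p\<close>, of k] k by simp
qed

end
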